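(* Let $\lambda\in\mathbb{C}$ with $0<|\lambda|<1$ and let $f_\lambda(z)=\lambda\sin(z)$. Then the Fatou set of $f_\lambda$ consists of a simply connected, completely invariant component $U$ (namely the Fatou component containing the attracting fixed point $0$).
   Context: The Fatou set $F(f)$ of an entire function $f$ is the set of points having a neighbourhood on which the iterates $(f^n)_{n\in\mathbb{N}}$ form a normal family; its complement is the Julia set $J(f)$. A set $U$ is completely invariant if $f(U)\subseteq U$ and $f^{-1}(U)\subseteq U$. *)

theory Defs
  imports "HOL-Analysis.Analysis"
begin

definition normal_family_on :: "complex set \<Rightarrow> (nat \<Rightarrow> complex \<Rightarrow> complex) \<Rightarrow> bool" where
  "normal_family_on S F \<longleftrightarrow>
     (\<forall>k :: nat \<Rightarrow> nat. \<exists>r. strict_mono r \<and>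
        ((\<exists>g. \<forall>K. compact K \<and> K \<subseteq> S \<longrightarrow>
                 uniform_limit K (\<lambda>n. F (k (r n))) g sequentially)
         \<or> (\<forall>K. compact K \<and> K \<subseteq> S \<longrightarrow>
                 (\<forall>B. \<forall>\<^sub>F n in sequentially. \<forall>z\<in>K. B \<le> norm (F (k (r n)) z)))))"

definition fatou_set :: "(complex \<Rightarrow> complex) \<Rightarrow> complex set" where
  "fatou_set f = {z. \<exists>V. open V \<and> z \<in> V \<and> normal_family_on V (\<lambda>n. f ^^ n)}"

definition julia_set :: "(complex \<Rightarrow> complex) \<Rightarrow> complex set" where
  "julia_set f = - fatou_set f"

definition completely_invariant :: "(complex \<Rightarrow> complex) \<Rightarrow> complex set \<Rightarrow> bool" where
  "completely_invariant f U \<longleftrightarrow> f ` U \<subseteq> U \<and> f -` U \<subseteq> U"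

end

theory Submission
  imports Defs "HOL-Complex_Analysis.Complex_Analysis"
begin

text \<open>Let \<open>A\<close> be the set of points whose orbits tend to 0 and \<open>A\<^sub>0\<close> its component
  containing 0. The critical values \<open>\<plusminus>\<lambda>\<close> of \<open>f\<close> lie in \<open>A\<^sub>0\<close>, since otherwise the inverse branches
  of \<open>f\<^sup>n\<close> fixing 0 would exist on a common disc and omit \<open>\<plusminus>\<lambda>\<close>, so that by Schottky's theorem their
  derivatives \<open>\<lambda>\<^sup>-\<^sup>n\<close> would be bounded.

  A point \<open>z\<^sub>0\<close> outside \<open>A\<close> is not in the Fatou set. If \<open>f\<^sup>n\<close> converges near \<open>z\<^sub>0\<close> along a
  subsequence, with \<open>f\<^sup>n z\<^sub>0\<close> tending to \<open>w\<close>, the inverse branches mapping \<open>f\<^sup>n z\<^sub>0\<close> to \<open>z\<^sub>0\<close> are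
  defined on the largest disc about \<open>w\<close> free of orbits of critical values; this disc meets \<open>A\<close>. They have
  a nonconstant limit \<open>H\<close>, and Hurwitz's theorem puts \<open>H a\<close> in \<open>A\<close> for \<open>a\<close> in \<open>A\<close>, hence \<open>a = 0\<close>. If
  \<open>f\<^sup>n\<close> tends to infinity near \<open>z\<^sub>0\<close>, its derivative does so too, and by Bloch's theorem the images
  contain large discs, which contain points that \<open>f\<close> maps into the real line and \<open>f \<circ> f\<close> into the
  unit disc.

  Every component of \<open>f\<^sup>-\<^sup>1(A\<^sub>0)\<close> contains a solution of \<open>sin c = 1\<close>. Such a \<open>c\<close> in \<open>A\<^sub>0\<close> makes
  \<open>A\<^sub>0\<close> symmetric about \<open>c\<close> as well as about 0, hence invariant under translation by
  \<open>2c \<in> \<pi>(4\<int> + 1)\<close>. By a universal chord argument \<open>A\<^sub>0\<close> then meets \<open>A\<^sub>0 + \<pi>\<close>, so the two are equal,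
  \<open>A\<^sub>0\<close> contains all these \<open>c\<close>, and \<open>f\<^sup>-\<^sup>1(A\<^sub>0) = A\<^sub>0 = A\<close>. Simple connectivity is the maximum principle.\<close>

subsection \<open>Preliminaries\<close>

text \<open>The difference takes values in the discrete set 2*pi*i*Z and is continuous, hence
  constant on a connected set.\<close>

lemma exp_eq_exp_imp_diff_constant:
  fixes u v :: "'a::topological_space \<Rightarrow> complex"
  assumes "connected S" "continuous_on S u" "continuous_on S v"
    and "\<And>x. x \<in> S \<Longrightarrow> exp (u x) = exp (v x)" and "x \<in> S" "y \<in> S"
  shows "u x - v x = u y - v y"
proof -
  have "(\<lambda>x. u x - v x) constant_on S"
  proof (rule continuous_discrete_range_constant[OF assms(1)])
    show "continuous_on S (\<lambda>x. u x - v x)" using assms by (intro continuous_intros)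
    fix x assume x: "x \<in> S"
    have "2 * pi \<le> norm (u y - v y - (u x - v x))"
      if y: "y \<in> S" "u y - v y \<noteq> u x - v x" for y
    proof -
      obtain m n :: int where m: "u x = v x + of_real (of_int (2 * m) * pi) * \<i>"
        and n: "u y = v y + of_real (of_int (2 * n) * pi) * \<i>"
        using assms(4)[OF x] assms(4)[OF y(1)] unfolding exp_eq by blast
      have "n \<noteq> m" using m n y by auto
      then have "1 \<le> \<bar>real_of_int (n - m)\<bar>" by linarith
      moreover have "u y - v y - (u x - v x) = of_real (2 * of_int (n - m) * pi) * \<i>"
        using m n by (simp add: algebra_simps)
      then have "norm (u y - v y - (u x - v x)) = \<bar>real_of_int (n - m)\<bar> * (2 * pi)"
        by (simp only: norm_mult norm_of_real norm_ii abs_mult) simp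
      ultimately show ?thesis using mult_right_mono[of 1 "\<bar>real_of_int (n - m)\<bar>" "2 * pi"] by simp
    qed
    then show "\<exists>e>0. \<forall>y. y \<in> S \<and> u y - v y \<noteq> u x - v x \<longrightarrow> e \<le> norm (u y - v y - (u x - v x))"
      by (intro exI[of _ "2*pi"]) auto
  qed
  then show ?thesis using assms unfolding constant_on_def by metis
qed

text \<open>An affine change of the values and a rescaling of the disc reduce this to Schottky's
  theorem for functions omitting 0 and 1 on the closed unit disc. The gain is uniformity: one
  \<open>M\<close> serves all \<open>h\<close>, \<open>c\<close> and \<open>\<rho>\<close>, so whole
  families of inverse branches are bounded at once.\<close>

lemma Schottky_ball:
  fixes a b :: complex
  assumes "a \<noteq> b" "0 \<le> t" "t < 1"
  obtains M where "\<And>h c \<rho> z. \<lbrakk>h holomorphic_on ball c \<rho>; norm (h c) \<le> R; 0 < \<rho>;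
      \<And>w. w \<in> ball c \<rho> \<Longrightarrow> h w \<noteq> a \<and> h w \<noteq> b; dist c z \<le> t * \<rho>\<rbrakk> \<Longrightarrow> norm (h z) \<le> M"
proof -
  \<comment> \<open>Shrinking by \<open>t1\<close>, strictly between \<open>t\<close> and 1, gives
    holomorphy on a closed disc. The point \<open>z\<close> then has modulus at most
    \<open>s\<close> after rescaling; for \<open>t = 0\<close> any positive \<open>s\<close> below 1
    will do.\<close>
  define t1 where "t1 = (1 + t) / 2"
  have t1: "0 < t1" "t1 < 1" "t < t1" using assms by (auto simp: t1_def)
  define s where "s = (if t = 0 then 1/2 else t / t1)"
  have s: "0 < s" "s < 1" "t \<le> s * t1" using t1 assms by (auto simp: s_def divide_simps)
  define M where "M = norm a + norm (b - a) * exp (pi * exp (pi * (2 + 2 * ((R + norm a) / norm (b - a)) + 12 * s / (1 - s))))"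
  show thesis
  proof (rule that[of M])
    fix h c \<rho> z
    assume hol: "h holomorphic_on ball c \<rho>" and hR: "norm (h c) \<le> R" and \<rho>: "0 < (\<rho>::real)"
      and om: "\<And>w. w \<in> ball c \<rho> \<Longrightarrow> h w \<noteq> a \<and> h w \<noteq> b" and z: "dist c z \<le> t * \<rho>"
    define k where "k = (\<lambda>w. (h (c + of_real (t1 * \<rho>) * w) - a) / (b - a))"
    have inb: "c + of_real (t1 * \<rho>) * w \<in> ball c \<rho>" if "w \<in> cball 0 1" for w
    proof -
      have "norm (of_real (t1 * \<rho>) * w) = t1 * \<rho> * norm w" using t1 \<rho> by (simp add: norm_mult)
      also have "\<dots> \<le> t1 * \<rho> * 1" using t1 \<rho> that by (intro mult_left_mono) auto
      also have "\<dots> < \<rho>" using t1 \<rho> by simp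
      finally show ?thesis by (simp add: dist_norm)
    qed
    have holk: "k holomorphic_on cball 0 1"
      unfolding k_def using \<open>a \<noteq> b\<close> inb
      by (intro holomorphic_intros holomorphic_on_compose_gen[OF _ hol, unfolded o_def]) auto
    have k0: "norm (k 0) \<le> (R + norm a) / norm (b - a)"
      using norm_triangle_ineq4[of "h c" a] hR assms
      by (auto simp: k_def norm_divide intro!: divide_right_mono)
    have kom: "\<not> (k w = 0 \<or> k w = 1)" if "w \<in> cball 0 1" for w
      using om[OF inb[OF that]] \<open>a \<noteq> b\<close> by (auto simp: k_def field_simps)
    define w where "w = (z - c) / of_real (t1 * \<rho>)"
    have "norm w = dist c z / (t1 * \<rho>)"
      using t1 \<rho> by (simp add: w_def norm_divide norm_mult dist_norm norm_minus_commute)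
    also have "\<dots> \<le> t * \<rho> / (t1 * \<rho>)" using z t1 \<rho> by (intro divide_right_mono) auto
    also have "\<dots> \<le> s" using s t1 \<rho> by (simp add: field_simps)
    finally have nw: "norm w \<le> s" .
    have "norm (k w) \<le> exp (pi * exp (pi * (2 + 2 * ((R + norm a) / norm (b - a)) + 12 * s / (1 - s))))"
      by (rule Schottky[OF holk k0 kom s(1,2) nw])
    moreover have "h z = a + (b - a) * k w"
      using t1 \<rho> \<open>a \<noteq> b\<close> by (simp add: k_def w_def)
    then have "norm (h z) \<le> norm a + norm (b - a) * norm (k w)"
      by (metis norm_mult norm_triangle_ineq)
    ultimately show "norm (h z) \<le> M"
      unfolding M_def by (smt (verit) mult_left_mono norm_ge_zero)
  qed
qed

text \<open>The index sequences in \<open>normal_family_on\<close> are arbitrary, so they may repeat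
  one iterate for ever. Either some value is taken infinitely often or every value only finitely
  often.\<close>

lemma nat_seq_subseq_const_or_at_top:
  fixes k :: "nat \<Rightarrow> nat"
  obtains r :: "nat \<Rightarrow> nat" where "strict_mono r" "\<exists>m. \<forall>n. k (r n) = m"
  | r :: "nat \<Rightarrow> nat" where "strict_mono r" "filterlim (\<lambda>n. k (r n)) at_top sequentially"
proof (cases "\<exists>m. infinite {n. k n = m}")
  case True
  then obtain m where m: "infinite {n. k n = m}" by blast
  have "strict_mono (enumerate {n. k n = m})" using m by (simp add: strict_mono_enumerate)
  moreover have "\<forall>n. k (enumerate {n. k n = m} n) = m" using enumerate_in_set[OF m] by auto
  ultimately show thesis using that(1) by blast
next
  case False
  have "filterlim k at_top sequentially"
    unfolding filterlim_at_top
  proof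
    fix Z
    have "finite (\<Union>m\<in>{..<Z}. {n. k n = m})" using False by auto
    moreover have "(\<Union>m\<in>{..<Z}. {n. k n = m}) = {n. \<not> Z \<le> k n}" by auto
    ultimately show "\<forall>\<^sub>F n in sequentially. Z \<le> k n"
      by (simp add: eventually_cofinite flip: cofinite_eq_sequentially)
  qed
  then show thesis using that(2)[of id] by (auto simp: strict_mono_def)
qed

text \<open>Used to pass to the limit in identities such as \<open>h n (w n) = z0\<close>, where
  function and argument both vary.\<close>

lemma uniform_limit_tendsto_moving:
  fixes F :: "nat \<Rightarrow> 'a::metric_space \<Rightarrow> 'b::metric_space"
  assumes ul: "uniform_limit K F g sequentially" and g: "continuous_on K g"
    and x: "\<forall>\<^sub>F n in sequentially. x n \<in> K" "x \<longlonglongrightarrow> l" "l \<in> K"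
  shows "(\<lambda>n. F n (x n)) \<longlonglongrightarrow> g l"
proof -
  have gx: "(\<lambda>n. g (x n)) \<longlonglongrightarrow> g l"
    using continuous_on_tendsto_compose[OF g x(2,3)] x(1) by simp
  show ?thesis
    unfolding tendsto_iff
  proof (intro allI impI)
    fix e :: real assume "0 < e"
    then have "\<forall>\<^sub>F n in sequentially. dist (g (x n)) (g l) < e / 2"
      "\<forall>\<^sub>F n in sequentially. \<forall>z\<in>K. dist (F n z) (g z) < e / 2"
      using tendstoD[OF gx, of "e / 2"] uniform_limitD[OF ul, of "e / 2"] by auto
    with x(1) show "\<forall>\<^sub>F n in sequentially. dist (F n (x n)) (g l) < e"
    proof eventually_elim
      case (elim n)
      then show ?case using dist_triangle_half_l[of "g (x n)" "F n (x n)" e "g l"]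
        by (metis dist_commute dist_triangle_half_r)
    qed
  qed
qed

lemma sin_eq_1_iff_complex: "sin c = 1 \<longleftrightarrow> (\<exists>n::int. c = of_real (pi / 2 + 2 * of_int n * pi))" for c :: complex
proof -
  have "sin c = 1 \<longleftrightarrow> sin c = sin (of_real (pi / 2))" unfolding sin_of_real by simp
  also have "\<dots> \<longleftrightarrow> (\<exists>n::int. c = of_real (pi / 2 + 2 * of_int n * pi))"
  proof
    assume "sin c = sin (of_real (pi / 2))"
    then obtain n where n: "n \<in> \<int>"
      "c = of_real (pi / 2) + of_real (2 * n * pi) \<or> c = - of_real (pi / 2) + of_real ((2 * n + 1) * pi)"
      unfolding complex_sin_eq by blast
    obtain k :: int where "n = of_int k" using n(1) by (auto elim: Ints_cases)
    then show "\<exists>n::int. c = of_real (pi / 2 + 2 * of_int n * pi)"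
      using n(2) by (intro exI[of _ k]) (auto simp: algebra_simps)
  next
    assume "\<exists>n::int. c = of_real (pi / 2 + 2 * of_int n * pi)"
    then obtain n :: int where "c = of_real (pi / 2 + 2 * of_int n * pi)" by blast
    then have "c = of_real (pi / 2) + of_real (2 * real_of_int n * pi)" by simp
    then show "sin c = sin (of_real (pi / 2))" unfolding complex_sin_eq using Ints_of_int by blast
  qed
  finally show ?thesis .
qed

text \<open>The closed unit disc meets the line Re = 1 only at 1, so \<open>1 - \<zeta> t\<close>
  stays in the right half-plane. There the principal logarithm is continuous and returns to its
  initial value, and \<open>L\<close> differs from it by a constant.\<close>

lemma continuous_log_one_minus_closed:
  fixes L \<zeta> :: "real \<Rightarrow> complex"
  assumes \<zeta>: "continuous_on {0..1} \<zeta>" "\<And>t. t \<in> {0..1} \<Longrightarrow> norm (\<zeta> t) \<le> 1 \<and> \<zeta> t \<noteq> 1" "\<zeta> 0 = \<zeta> 1"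
    and L: "continuous_on {0..1} L" "\<And>t. t \<in> {0..1} \<Longrightarrow> exp (L t) = \<kappa> * (1 - \<zeta> t)" and "\<kappa> \<noteq> 0"
  shows "L 0 = L 1"
proof -
  have Re_pos: "0 < Re (1 - \<zeta> t)" if t: "t \<in> {0..1}" for t
  proof (rule ccontr)
    assume "\<not> 0 < Re (1 - \<zeta> t)"
    then have "1 \<le> Re (\<zeta> t)" by simp
    moreover have "(Re (\<zeta> t))\<^sup>2 + (Im (\<zeta> t))\<^sup>2 \<le> 1"
      using \<zeta>(2)[OF t] by (metis cmod_power2 norm_ge_zero power_le_one)
    moreover have "1 \<le> (Re (\<zeta> t))\<^sup>2" using \<open>1 \<le> Re (\<zeta> t)\<close> by (rule one_le_power)
    ultimately have "(Im (\<zeta> t))\<^sup>2 = 0" "(Re (\<zeta> t))\<^sup>2 = 1"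
      using zero_le_power2[of "Im (\<zeta> t)"] by linarith+
    then have "\<zeta> t = 1" using \<open>1 \<le> Re (\<zeta> t)\<close> by (auto simp: complex_eq_iff power2_eq_1_iff)
    then show False using \<zeta>(2)[OF t] by simp
  qed
  define v where "v = (\<lambda>t. Ln \<kappa> + Ln (1 - \<zeta> t))"
  have "L 0 - v 0 = L 1 - v 1"
  proof (rule exp_eq_exp_imp_diff_constant[of "{0..1}"])
    show "continuous_on {0..1} v" unfolding v_def
      using \<zeta>(1) Re_pos by (intro continuous_intros) (auto simp: complex_nonpos_Reals_iff not_le)
    show "exp (L t) = exp (v t)" if t: "t \<in> {0..1}" for t
    proof -
      have "1 - \<zeta> t \<noteq> 0" using \<zeta>(2)[OF t] by simp
      then show ?thesis using L(2)[OF t] \<open>\<kappa> \<noteq> 0\<close> by (simp add: v_def exp_add)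
    qed
  qed (use L in auto)
  then show ?thesis by (simp add: v_def \<zeta>(3))
qed

text \<open>Under \<open>z \<mapsto> exp (2\<pi>\<i>z/p)\<close> an arc from \<open>a\<close> to \<open>a + p\<close> becomes a loop \<open>\<gamma>\<close> of winding
  number 1 about 0. If \<open>\<gamma>\<close> missed its rotated copy \<open>\<omega>\<gamma>\<close>, then \<open>\<gamma> s - \<omega> \<gamma> t\<close> would have a
  continuous logarithm on the unit square, which is unchanged along the horizontal and vertical
  sides, because \<open>\<omega>\<gamma>\<close> has winding number 0 about a point of maximal modulus of \<open>\<gamma>\<close> and vice
  versa, but changes by \<open>2\<pi>\<i>\<close> along the diagonal.\<close>

lemma invariant_path_connected_meets_translate:
  fixes S :: "complex set" and p q :: real
  assumes S: "path_connected S" "a \<in> S" and "p \<noteq> 0"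
    and inv: "\<And>z j. z \<in> S \<Longrightarrow> z + of_int j * of_real p \<in> S"
  shows "\<exists>z\<in>S. z + of_real q \<in> S"
proof (rule ccontr)
  assume disj: "\<not> (\<exists>z\<in>S. z + of_real q \<in> S)"
  have "a + of_real p \<in> S" using inv[OF S(2), of 1] by simp
  then obtain G where G: "path G" "path_image G \<subseteq> S" "pathstart G = a" "pathfinish G = a + of_real p"
    using S unfolding path_connected_def by blast
  have GS: "G t \<in> S" if "t \<in> {0..1}" for t using G(2) that by (auto simp: path_image_def)
  have G01: "G 1 = G 0 + of_real p" using G(3,4) by (simp add: pathstart_def pathfinish_def)
  have contG: "continuous_on {0..1} G" using G(1) by (simp add: path_def)
  define \<gamma> where "\<gamma> = (\<lambda>t. exp (2 * of_real pi * \<i> * G t / of_real p))"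
  define \<omega> where "\<omega> = exp (2 * of_real pi * \<i> * of_real q / of_real p)"
  have cont\<gamma>: "continuous_on {0..1} \<gamma>" unfolding \<gamma>_def using \<open>p \<noteq> 0\<close> by (intro continuous_intros contG) auto
  have \<gamma>nz: "\<gamma> t \<noteq> 0" for t by (simp add: \<gamma>_def)
  have \<omega>nz: "\<omega> \<noteq> 0" by (simp add: \<omega>_def)
  have "\<omega> = exp (\<i> * of_real (2 * pi * q / p))" by (simp add: \<omega>_def mult_ac)
  then have n\<omega>: "norm \<omega> = 1" by (simp only: norm_exp_i_times)
  have \<gamma>01: "\<gamma> 1 = \<gamma> 0"
  proof -
    have "2 * of_real pi * \<i> * G 1 / of_real p = 2 * of_real pi * \<i> * G 0 / of_real p + 2 * of_real pi * \<i>"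
      using \<open>p \<noteq> 0\<close> by (simp add: G01 field_simps)
    then show ?thesis unfolding \<gamma>_def by (simp add: exp_add)
  qed
  have ne: "\<gamma> s \<noteq> \<omega> * \<gamma> t" if st: "s \<in> {0..1}" "t \<in> {0..1}" for s t
  proof
    assume "\<gamma> s = \<omega> * \<gamma> t"
    then have "exp (2 * of_real pi * \<i> * G s / of_real p)
        = exp (2 * of_real pi * \<i> * of_real q / of_real p + 2 * of_real pi * \<i> * G t / of_real p)"
      by (simp add: \<gamma>_def \<omega>_def exp_add)
    then obtain j :: int where "2 * of_real pi * \<i> * G s / of_real p
        = 2 * of_real pi * \<i> * of_real q / of_real p + 2 * of_real pi * \<i> * G t / of_real p
          + of_real (of_int (2 * j) * pi) * \<i>"
      unfolding exp_eq by blast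
    then have "2 * of_real pi * \<i> * G s / of_real p
        = 2 * of_real pi * \<i> * (of_real q + G t + of_int j * of_real p) / of_real p"
      using \<open>p \<noteq> 0\<close> by (simp add: field_simps)
    then have "G s = (G t + of_int j * of_real p) + of_real q"
      using \<open>p \<noteq> 0\<close> by (simp add: add_ac)
    then show False using disj GS[OF st(1)] inv[OF GS[OF st(2)], of j] by metis
  qed
  have "continuous_on ({0..1} \<times> {0..1}) (\<lambda>x. \<gamma> (fst x) - \<omega> * \<gamma> (snd x))"
    by (intro continuous_intros continuous_on_compose2[OF cont\<gamma>]) auto
  moreover have "contractible ({0..1::real} \<times> {0..1::real})"
    by (intro convex_imp_contractible convex_Times) auto
  ultimately obtain L where L: "continuous_on ({0..1} \<times> {0..1}) L"
    "\<And>x. x \<in> {0..1} \<times> {0..1} \<Longrightarrow> \<gamma> (fst x) - \<omega> * \<gamma> (snd x) = exp (L x)"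
    by (rule continuous_logarithm_on_contractible) (use ne in auto)
  have expL: "exp (L (s, t)) = \<gamma> s - \<omega> * \<gamma> t" if "s \<in> {0..1}" "t \<in> {0..1}" for s t
    using L(2)[of "(s, t)"] that by simp
  have contL: "continuous_on {0..1} (\<lambda>t. L (g t, h t))"
    if "continuous_on {0..1} g" "continuous_on {0..1} h" "\<And>t. t \<in> {0..1} \<Longrightarrow> g t \<in> {0..1} \<and> h t \<in> {0..1}"
    for g h :: "real \<Rightarrow> real"
    by (rule continuous_on_compose2[OF L(1) continuous_on_Pair[OF that(1,2)]]) (use that(3) in blast)
  obtain t0 where t0: "t0 \<in> {0..1}" "\<And>t. t \<in> {0..1} \<Longrightarrow> norm (\<gamma> t) \<le> norm (\<gamma> t0)"
    using continuous_attains_sup[of "{0..1}" "\<lambda>t. norm (\<gamma> t)"] continuous_on_norm[OF cont\<gamma>] by auto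
  have row: "L (0, t0) = L (1, t0)"
  proof (rule continuous_log_one_minus_closed[where L = "\<lambda>s. L (s, t0)" and \<zeta> = "\<lambda>s. \<gamma> s / (\<omega> * \<gamma> t0)"
          and \<kappa> = "- (\<omega> * \<gamma> t0)"])
    show "continuous_on {0..1} (\<lambda>s. \<gamma> s / (\<omega> * \<gamma> t0))"
      using \<gamma>nz \<omega>nz by (intro continuous_intros cont\<gamma>) auto
    show "norm (\<gamma> s / (\<omega> * \<gamma> t0)) \<le> 1 \<and> \<gamma> s / (\<omega> * \<gamma> t0) \<noteq> 1" if "s \<in> {0..1}" for s
      using ne[OF that t0(1)] t0(2)[OF that] \<gamma>nz \<omega>nz n\<omega> by (simp add: norm_divide norm_mult)
    show "exp (L (s, t0)) = - (\<omega> * \<gamma> t0) * (1 - \<gamma> s / (\<omega> * \<gamma> t0))" if "s \<in> {0..1}" for s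
      using expL[OF that t0(1)] \<gamma>nz \<omega>nz by (simp add: right_diff_distrib)
  qed (use \<gamma>01 \<gamma>nz \<omega>nz t0 in \<open>auto intro!: contL continuous_intros\<close>)
  have col: "L (t0, 0) = L (t0, 1)"
  proof (rule continuous_log_one_minus_closed[where L = "\<lambda>t. L (t0, t)" and \<zeta> = "\<lambda>t. \<omega> * \<gamma> t / \<gamma> t0"
          and \<kappa> = "\<gamma> t0"])
    show "continuous_on {0..1} (\<lambda>t. \<omega> * \<gamma> t / \<gamma> t0)"
      using \<gamma>nz by (intro continuous_intros cont\<gamma>) auto
    show "norm (\<omega> * \<gamma> t / \<gamma> t0) \<le> 1 \<and> \<omega> * \<gamma> t / \<gamma> t0 \<noteq> 1" if "t \<in> {0..1}" for t
      using ne[OF t0(1) that] t0(2)[OF that] \<gamma>nz n\<omega> by (auto simp: norm_divide norm_mult)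
    show "exp (L (t0, t)) = \<gamma> t0 * (1 - \<omega> * \<gamma> t / \<gamma> t0)" if "t \<in> {0..1}" for t
      using expL[OF t0(1) that] \<gamma>nz by (simp add: right_diff_distrib)
  qed (use \<gamma>01 \<gamma>nz t0 in \<open>auto intro!: contL continuous_intros\<close>)
  \<comment> \<open>As \<open>\<gamma> 0 = \<gamma> 1\<close>, opposite sides of the square carry
    logarithms of the same function. Their difference is constant, which moves the equality from row
    \<open>t0\<close> to the bottom side; the next fact does the same for columns.\<close>
  have "L (1, 0) - L (0, 0) = L (1, t0) - L (0, t0)"
    by (rule exp_eq_exp_imp_diff_constant[of "{0..1}" "\<lambda>t. L (1, t)" "\<lambda>t. L (0, t)"])
      (use t0 expL \<gamma>01 in \<open>auto intro!: contL continuous_intros\<close>)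
  moreover have "L (1, 1) - L (1, 0) = L (t0, 1) - L (t0, 0)"
    by (rule exp_eq_exp_imp_diff_constant[of "{0..1}" "\<lambda>s. L (s, 1)" "\<lambda>s. L (s, 0)"])
      (use t0 expL \<gamma>01 in \<open>auto intro!: contL continuous_intros\<close>)
  ultimately have L01: "L (0, 0) = L (1, 1)" using row col by simp
  \<comment> \<open>An explicit logarithm on the diagonal, where the function is
    \<open>(1 - \<omega>) * \<gamma> t\<close>; it grows by 2*pi*i from 0 to 1.\<close>
  define v where "v = (\<lambda>t. Ln (1 - \<omega>) + 2 * of_real pi * \<i> * G t / of_real p)"
  have \<omega>1: "\<omega> \<noteq> 1" using ne[of 0 0] by auto
  have "L (0, 0) - v 0 = L (1, 1) - v 1"
  proof (rule exp_eq_exp_imp_diff_constant[of "{0..1}" "\<lambda>t. L (t, t)" v])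
    show "continuous_on {0..1} v" unfolding v_def using \<open>p \<noteq> 0\<close> by (intro continuous_intros contG) auto
    show "exp (L (t, t)) = exp (v t)" if "t \<in> {0..1}" for t
      using expL[OF that that] \<omega>1 by (simp add: v_def exp_add \<gamma>_def algebra_simps)
  qed (auto intro!: contL continuous_intros)
  then have "v 0 = v 1" using L01 by simp
  then have "G 0 = G 1" using \<open>p \<noteq> 0\<close> by (simp add: v_def)
  then show False using G01 \<open>p \<noteq> 0\<close> by simp
qed

subsection \<open>The basin of attraction of 0\<close>

locale sine_map =
  fixes lam :: complex
  assumes lam0: "0 < norm lam" and lam1: "norm lam < 1"
begin

definition f :: "complex \<Rightarrow> complex" where "f z = lam * sin z"

definition basin :: "complex set" where "basin = {z. (\<lambda>n. (f ^^ n) z) \<longlonglongrightarrow> 0}"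

definition immediate_basin :: "complex set" where
  "immediate_basin = connected_component_set basin 0"

lemma lam_nz: "lam \<noteq> 0" using lam0 by auto

lemma f_0 [simp]: "f 0 = 0" by (simp add: f_def)

lemma funpow_f_0 [simp]: "(f ^^ n) 0 = 0" by (induction n) auto

lemma holomorphic_f: "f holomorphic_on S"
  unfolding f_def by (intro holomorphic_intros)

lemma holomorphic_funpow: "(f ^^ n) holomorphic_on S"
proof (induction n)
  case 0 then show ?case by (simp add: id_def)
next
  case (Suc n)
  then show ?case
    using holomorphic_on_compose[OF Suc holomorphic_f] by (simp add: o_def)
qed

lemma continuous_funpow: "continuous_on S (f ^^ n)"
  by (intro holomorphic_on_imp_continuous_on holomorphic_funpow)

lemma funpow_f_minus: "(f ^^ n) (- z) = - (f ^^ n) z"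
  by (induction n) (auto simp: f_def)

lemma f_in_basin_iff: "f z \<in> basin \<longleftrightarrow> z \<in> basin"
proof -
  have "(\<lambda>n. (f ^^ n) (f z)) = (\<lambda>n. (f ^^ Suc n) z)" by (simp add: funpow_swap1)
  then show ?thesis unfolding basin_def mem_Collect_eq by (simp only: filterlim_sequentially_Suc[where f = "\<lambda>n. (f ^^ n) z"])
qed

lemma funpow_in_basin_iff: "(f ^^ n) z \<in> basin \<longleftrightarrow> z \<in> basin"
  by (induction n) (auto simp: f_in_basin_iff)

lemma minus_in_basin_iff: "- z \<in> basin \<longleftrightarrow> z \<in> basin"
  using tendsto_minus_cancel_left[of "\<lambda>n. (f ^^ n) z" 0 sequentially]
  by (simp add: basin_def funpow_f_minus)

lemma basin_sin_cong: "sin z = sin w \<Longrightarrow> z \<in> basin \<longleftrightarrow> w \<in> basin"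
  using f_in_basin_iff[of z] f_in_basin_iff[of w] by (simp add: f_def)

lemma zero_in_basin: "0 \<in> basin" by (simp add: basin_def)

text \<open>The multiplier at 0 is \<open>lam\<close>, so any \<open>c\<close> between
  \<open>norm lam\<close> and 1 bounds the quotient \<open>f h / h\<close> near 0; the midpoint is
  taken.\<close>

lemma local_contraction:
  obtains r c where "0 < r" "0 < c" "c < 1" "\<And>n z. norm z < r \<Longrightarrow> norm ((f ^^ n) z) \<le> c ^ n * norm z"
proof -
  have "(f has_field_derivative lam * cos 0) (at 0)"
    unfolding f_def by (auto intro!: derivative_eq_intros)
  then have "((\<lambda>h. f h / h) \<longlongrightarrow> lam) (at 0)"
    unfolding DERIV_def by simp
  then have "((\<lambda>h. norm (f h / h)) \<longlongrightarrow> norm lam) (at 0)"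
    by (intro tendsto_norm)
  moreover define c where "c = (1 + norm lam) / 2"
  have c: "norm lam < c" "0 < c" "c < 1" using lam0 lam1 unfolding c_def by (simp_all add: field_simps del: zero_less_norm_iff)
  ultimately have "eventually (\<lambda>h. norm (f h / h) < c) (at 0)"
    using order_tendstoD(2) by blast
  then obtain r where r: "0 < r" "\<And>h. h \<noteq> 0 \<Longrightarrow> norm h < r \<Longrightarrow> norm (f h / h) < c"
    unfolding eventually_at by (auto simp: dist_norm)
  have step: "norm (f h) \<le> c * norm h" if "norm h < r" for h
    using r(2)[of h] that by (cases "h = 0") (auto simp: norm_divide field_simps)
  have "norm ((f ^^ n) z) \<le> c ^ n * norm z" if z: "norm z < r" for n z
  proof (induction n)
    case (Suc n)
    have "c ^ n * norm z \<le> 1 * norm z" using c by (intro mult_right_mono power_le_one) auto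
    then have "norm (f ((f ^^ n) z)) \<le> c * norm ((f ^^ n) z)" using Suc z by (intro step) auto
    also have "\<dots> \<le> c * (c ^ n * norm z)" using Suc c by (intro mult_left_mono) auto
    finally show ?case by (simp add: mult_ac)
  qed auto
  with r(1) c(2,3) show thesis by (rule that)
qed

lemma basin_eq_UN:
  obtains r c where "0 < r" "0 < c" "c < 1" "\<And>n z. norm z < r \<Longrightarrow> norm ((f ^^ n) z) \<le> c ^ n * norm z"
    "ball 0 r \<subseteq> basin" "basin = (\<Union>n. (f ^^ n) -` ball 0 r)"
proof -
  obtain r c where rc: "0 < r" "0 < c" "c < 1" "\<And>n z. norm z < r \<Longrightarrow> norm ((f ^^ n) z) \<le> c ^ n * norm z"
    by (rule local_contraction) (rule that)
  have sub: "ball 0 r \<subseteq> basin"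
  proof
    fix z :: complex assume z: "z \<in> ball 0 r"
    have "(\<lambda>n. c ^ n * norm z) \<longlonglongrightarrow> 0 * norm z"
      using rc by (intro tendsto_intros LIMSEQ_power_zero) auto
    then have "(\<lambda>n. c ^ n * norm z) \<longlonglongrightarrow> 0" by simp
    moreover have "\<forall>\<^sub>F n in sequentially. norm ((f ^^ n) z) \<le> c ^ n * norm z"
      using z by (intro always_eventually allI rc(4)) simp
    ultimately have "(\<lambda>n. (f ^^ n) z) \<longlonglongrightarrow> 0" by (rule Lim_null_comparison[rotated])
    then show "z \<in> basin" by (simp add: basin_def)
  qed
  have "basin = (\<Union>n. (f ^^ n) -` ball 0 r)"
  proof
    show "basin \<subseteq> (\<Union>n. (f ^^ n) -` ball 0 r)"
    proof
      fix z assume "z \<in> basin"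
      then have "(\<lambda>n. (f ^^ n) z) \<longlonglongrightarrow> 0" by (simp add: basin_def)
      then have "\<forall>\<^sub>F n in sequentially. (f ^^ n) z \<in> ball 0 r"
        using rc(1) topological_tendstoD by (metis centre_in_ball open_ball)
      then show "z \<in> (\<Union>n. (f ^^ n) -` ball 0 r)"
        by (auto simp: eventually_sequentially)
    qed
    show "(\<Union>n. (f ^^ n) -` ball 0 r) \<subseteq> basin"
      using sub funpow_in_basin_iff by blast
  qed
  with rc sub show thesis by (rule that)
qed

lemma open_basin: "open basin"
proof -
  obtain r c where rc: "0 < r" "0 < c" "c < 1" "\<And>n z. norm z < r \<Longrightarrow> norm ((f ^^ n) z) \<le> c ^ n * norm z"
    and A: "ball 0 r \<subseteq> basin" "basin = (\<Union>n. (f ^^ n) -` ball 0 r)"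
    by (rule basin_eq_UN) (rule that)
  then show ?thesis
    unfolding A(2) by (intro open_UN ballI open_vimage continuous_funpow open_ball)
qed

text \<open>By compactness all points of \<open>K\<close> have entered the contracting disc by a
  common time \<open>m\<close>; afterwards the decay is geometric.\<close>

lemma uniform_limit_basin:
  assumes K: "compact K" "K \<subseteq> basin"
  shows "uniform_limit K (\<lambda>n. f ^^ n) (\<lambda>_. 0) sequentially"
proof -
  obtain r c where rc: "0 < r" "0 < c" "c < 1" "\<And>n z. norm z < r \<Longrightarrow> norm ((f ^^ n) z) \<le> c ^ n * norm z"
    and A: "ball 0 r \<subseteq> basin" "basin = (\<Union>n. (f ^^ n) -` ball 0 r)"
    by (rule basin_eq_UN) (rule that)
  have "open ((f ^^ n) -` ball 0 r)" for n by (simp add: open_vimage continuous_funpow)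
  moreover have "K \<subseteq> (\<Union>n\<in>UNIV. (f ^^ n) -` ball 0 r)" using K(2) A(2) by simp
  ultimately obtain N where N: "finite N" "K \<subseteq> (\<Union>n\<in>N. (f ^^ n) -` ball 0 r)"
    by (rule compactE_image[OF K(1)]) (rule that)
  define m where "m = Max (insert 0 N)"
  have bd: "norm ((f ^^ n) z) \<le> c ^ (n - m) * r" if z: "z \<in> K" and n: "n \<ge> m" for n z
  proof -
    obtain j where j: "j \<in> N" "norm ((f ^^ j) z) < r" using N(2) z by auto
    have jm: "j \<le> m" using N j by (simp add: m_def)
    have "(f ^^ n) z = (f ^^ (n - j)) ((f ^^ j) z)"
      using jm n by (metis comp_apply funpow_add le_add_diff_inverse2 le_trans)
    then have "norm ((f ^^ n) z) \<le> c ^ (n - j) * norm ((f ^^ j) z)" using rc(4) j by simp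
    also have "\<dots> \<le> c ^ (n - m) * r"
      using jm rc j n by (intro mult_mono power_decreasing) auto
    finally show ?thesis .
  qed
  show ?thesis
    unfolding uniform_limit_iff
  proof (intro allI impI)
    fix e :: real assume e: "e > 0"
    have "(\<lambda>n. c ^ n * r) \<longlonglongrightarrow> 0 * r" using rc by (intro tendsto_intros LIMSEQ_power_zero) auto
    then have "\<forall>\<^sub>F n in sequentially. c ^ n * r < e" using e by (intro order_tendstoD(2)) auto
    then obtain n0 where n0: "\<And>n. n \<ge> n0 \<Longrightarrow> c ^ n * r < e" by (auto simp: eventually_sequentially)
    show "\<forall>\<^sub>F n in sequentially. \<forall>x\<in>K. dist ((f ^^ n) x) 0 < e"
      unfolding eventually_sequentially
    proof (intro exI allI impI ballI)
      fix n x assume n: "n \<ge> m + n0" and x: "x \<in> K"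
      have "norm ((f ^^ n) x) \<le> c ^ (n - m) * r" using bd[OF x, of n] n by simp
      also have "\<dots> < e" using n0[of "n - m"] n by linarith
      finally show "dist ((f ^^ n) x) 0 < e" by simp
    qed
  qed
qed

lemma basin_subset_fatou_set: "basin \<subseteq> fatou_set f"
proof -
  have "normal_family_on basin (\<lambda>n. f ^^ n)"
    unfolding normal_family_on_def
  proof
    fix k :: "nat \<Rightarrow> nat"
    have "\<exists>r g. strict_mono r \<and> (\<forall>K. compact K \<and> K \<subseteq> basin \<longrightarrow>
                 uniform_limit K (\<lambda>n. f ^^ k (r n)) g sequentially)"
    proof (cases rule: nat_seq_subseq_const_or_at_top[of k])
      case (1 r)
      then obtain m where m: "\<And>n. k (r n) = m" by blast
      show ?thesis
        by (rule exI[of _ r], rule exI[of _ "f ^^ m"]) (auto simp: 1(1) m uniform_limit_const)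
    next
      case (2 r)
      show ?thesis
        by (rule exI[of _ r], rule exI[of _ "\<lambda>_. 0"])
          (auto simp: 2(1) intro!: filterlim_compose[OF uniform_limit_basin 2(2)])
    qed
    then show "\<exists>r. strict_mono r \<and> ((\<exists>g. \<forall>K. compact K \<and> K \<subseteq> basin \<longrightarrow>
                 uniform_limit K (\<lambda>n. f ^^ k (r n)) g sequentially)
         \<or> (\<forall>K. compact K \<and> K \<subseteq> basin \<longrightarrow>
                 (\<forall>B. \<forall>\<^sub>F n in sequentially. \<forall>z\<in>K. B \<le> norm ((f ^^ k (r n)) z))))"
      by meson
  qed
  then show ?thesis unfolding fatou_set_def using open_basin by blast
qed

subsection \<open>Inverse branches and critical values\<close>

text \<open>\<open>h / lam\<close> omits the critical values 1 and -1, so it has a holomorphic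
  arccosine on a contractible set. The solutions of \<open>sin x = sin y\<close> are related by
  translations and reflections, and composing with one of these makes the branch pass through
  \<open>q\<close>.\<close>

lemma lift_through_f:
  assumes S: "contractible S" and h: "h holomorphic_on S"
    and avoid: "\<And>z. z \<in> S \<Longrightarrow> h z \<noteq> lam \<and> h z \<noteq> - lam" and p: "p \<in> S" "f q = h p"
  shows "\<exists>g. g holomorphic_on S \<and> g p = q \<and> (\<forall>z\<in>S. f (g z) = h z)"
proof -
  have "(\<lambda>z. h z / lam) holomorphic_on S" using h lam_nz by (intro holomorphic_intros) auto
  moreover have "h z / lam \<noteq> 1 \<and> h z / lam \<noteq> - 1" if "z \<in> S" for z
    using avoid[OF that] lam_nz by (auto simp: field_simps)
  ultimately obtain g0 where g0: "g0 holomorphic_on S" "\<And>z. z \<in> S \<Longrightarrow> h z / lam = cos (g0 z)"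
    using contractible_imp_holomorphic_arccos[OF _ S] by (smt (verit))
  define g1 where "g1 = (\<lambda>z. of_real (pi / 2) - g0 z)"
  have g1: "g1 holomorphic_on S" unfolding g1_def by (intro holomorphic_intros g0)
  have f1: "f (g1 z) = h z" if "z \<in> S" for z
  proof -
    have "sin (g1 z) = cos (g0 z)"
      unfolding g1_def sin_diff sin_of_real[symmetric] cos_of_real[symmetric] by simp
    then show ?thesis using g0(2)[OF that] lam_nz by (simp add: f_def field_simps)
  qed
  have "f q = f (g1 p)" using p f1[OF p(1)] by simp
  then have "sin q = sin (g1 p)" using lam_nz by (simp add: f_def)
  then obtain n where n: "n \<in> \<int>"
      "q = g1 p + of_real (2 * n * pi) \<or> q = - g1 p + of_real ((2 * n + 1) * pi)"
    unfolding complex_sin_eq by blast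
  from n(2) show ?thesis
  proof
    assume q: "q = g1 p + of_real (2 * n * pi)"
    have "sin (g1 z + of_real (2 * n * pi)) = sin (g1 z)" for z
      unfolding complex_sin_eq using n(1) by blast
    then show ?thesis using g1 f1 q
      by (intro exI[of _ "\<lambda>z. g1 z + of_real (2 * n * pi)"]) (auto simp: f_def intro!: holomorphic_intros)
  next
    assume q: "q = - g1 p + of_real ((2 * n + 1) * pi)"
    have "sin (- g1 z + of_real ((2 * n + 1) * pi)) = sin (g1 z)" for z
      unfolding complex_sin_eq using n(1) by blast
    then show ?thesis using g1 f1 q
      by (intro exI[of _ "\<lambda>z. - g1 z + of_real ((2 * n + 1) * pi)"])
        (auto simp: f_def intro!: holomorphic_intros)
  qed
qed

text \<open>A branch of the \<open>n\<close>-th iterate through \<open>f q\<close> is lifted once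
  more through \<open>f\<close>. The forward invariant set \<open>Q\<close> limits the base values
  for which \<open>avoid\<close> must be known: \<open>{0}\<close> for the branches fixing 0,
  \<open>UNIV\<close> when the disc avoids the critical orbits.\<close>

lemma inverse_branch:
  assumes B: "contractible B" "p \<in> B" and Q: "f ` Q \<subseteq> Q"
    and avoid: "\<And>h m z. \<lbrakk>h holomorphic_on B; \<forall>z\<in>B. (f ^^ m) (h z) = z; h p \<in> Q; z \<in> B\<rbrakk>
      \<Longrightarrow> h z \<noteq> lam \<and> h z \<noteq> - lam"
    and "q \<in> Q" "(f ^^ n) q = p"
  shows "\<exists>h. h holomorphic_on B \<and> h p = q \<and> (\<forall>z\<in>B. (f ^^ n) (h z) = z)"
  using assms(5,6)
proof (induction n arbitrary: q)
  case 0
  then show ?case by (intro exI[of _ id]) (auto simp: id_def)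
next
  case (Suc n)
  have "f q \<in> Q" "(f ^^ n) (f q) = p" using Suc.prems Q by (auto simp: funpow_swap1)
  then obtain h where h: "h holomorphic_on B" "h p = f q" "\<forall>z\<in>B. (f ^^ n) (h z) = z"
    using Suc.IH by blast
  have "\<exists>g. g holomorphic_on B \<and> g p = q \<and> (\<forall>z\<in>B. f (g z) = h z)"
  proof (rule lift_through_f[OF B(1) h(1) _ B(2)])
    show "h z \<noteq> lam \<and> h z \<noteq> - lam" if "z \<in> B" for z
      using avoid[OF h(1) h(3) _ that] h(2) \<open>f q \<in> Q\<close> by simp
  qed (use h in simp)
  then obtain g where "g holomorphic_on B" "g p = q" "\<forall>z\<in>B. f (g z) = h z" by blast
  then show ?case using h(3) by (intro exI[of _ g]) (auto simp: funpow_swap1)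
qed

section \<open>The immediate basin and the critical values\<close>

lemma zero_in_immediate_basin: "0 \<in> immediate_basin"
  by (simp add: immediate_basin_def zero_in_basin)

lemma immediate_basin_subset: "immediate_basin \<subseteq> basin"
  by (simp add: immediate_basin_def connected_component_subset)

lemma connected_immediate_basin: "connected immediate_basin"
  by (simp add: immediate_basin_def)

lemma open_immediate_basin: "open immediate_basin"
  by (simp add: immediate_basin_def open_connected_component open_basin)

lemma connected_subset_immediate_basin:
  assumes "connected C" "C \<subseteq> basin" "x \<in> C" "x \<in> immediate_basin"
  shows "C \<subseteq> immediate_basin"
proof -
  have "C \<subseteq> connected_component_set basin x" using assms by (intro connected_component_maximal)
  then show ?thesis using assms(4) unfolding immediate_basin_def
    by (metis connected_component_eq)
qed

text \<open>The image of the component is connected, lies in the basin and meets the component.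
  Applied below to point reflections and to the translation by pi.\<close>

lemma immediate_basin_map:
  assumes T: "continuous_on UNIV T" "\<And>z. z \<in> basin \<Longrightarrow> T z \<in> basin"
    and "x \<in> immediate_basin" "T x \<in> immediate_basin" and "z \<in> immediate_basin"
  shows "T z \<in> immediate_basin"
proof -
  have "connected (T ` immediate_basin)"
    by (intro connected_continuous_image connected_immediate_basin continuous_on_subset[OF T(1)]) simp
  moreover have "T ` immediate_basin \<subseteq> basin" using T(2) immediate_basin_subset by blast
  ultimately show ?thesis
    using connected_subset_immediate_basin[of "T ` immediate_basin" "T x"] assms by blast
qed

lemma minus_in_immediate_basin: "z \<in> immediate_basin \<Longrightarrow> - z \<in> immediate_basin"
  by (rule immediate_basin_map[where x = 0])
    (auto simp: zero_in_immediate_basin minus_in_basin_iff intro!: continuous_intros)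

lemma critical_value_in_immediate_basin: "lam \<in> immediate_basin"
proof (rule ccontr)
  assume no: "lam \<notin> immediate_basin"
  then have no': "- lam \<notin> immediate_basin" using minus_in_immediate_basin by force
  obtain r c where rc: "0 < r" "0 < c" "c < 1" "\<And>n z. norm z < r \<Longrightarrow> norm ((f ^^ n) z) \<le> c ^ n * norm z"
    and A: "ball 0 r \<subseteq> basin" "basin = (\<Union>n. (f ^^ n) -` ball 0 r)"
    by (rule basin_eq_UN) (rule that)
  have avoid: "h z \<noteq> lam \<and> h z \<noteq> - lam"
    if "h holomorphic_on ball 0 r" "\<forall>z\<in>ball 0 r. (f ^^ m) (h z) = z" "h 0 \<in> {0}" "z \<in> ball 0 r" for h m z
  proof -
    have "connected (h ` ball 0 r)"
      by (intro connected_continuous_image holomorphic_on_imp_continuous_on that(1)) simp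
    moreover have "h ` ball 0 r \<subseteq> basin"
      using that(2) A(1) funpow_in_basin_iff by (metis image_subsetI subsetD)
    moreover have "0 \<in> h ` ball 0 r" using that(3) rc(1) by force
    ultimately have "h ` ball 0 r \<subseteq> immediate_basin"
      using connected_subset_immediate_basin zero_in_immediate_basin by blast
    then show ?thesis using no no' that(4) by (metis imageI subsetD)
  qed
  have ex: "\<exists>h. h holomorphic_on ball 0 r \<and> h 0 = 0 \<and> (\<forall>z\<in>ball 0 r. (f ^^ n) (h z) = z)" for n
    by (rule inverse_branch[where Q = "{0}"])
      (use avoid rc in \<open>auto intro!: convex_imp_contractible\<close>)
  obtain M where M: "\<And>h c \<rho> z. \<lbrakk>h holomorphic_on ball c \<rho>; norm (h c) \<le> 0; 0 < \<rho>;
      \<And>w. w \<in> ball c \<rho> \<Longrightarrow> h w \<noteq> lam \<and> h w \<noteq> - lam; dist c z \<le> 1/2 * \<rho>\<rbrakk> \<Longrightarrow> norm (h z) \<le> M"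
    by (rule Schottky_ball[of lam "- lam" "1/2" 0]) (use lam_nz in \<open>auto simp: eq_neg_iff_add_eq_0\<close>)
  \<comment> \<open>Small enough that by Schwarz's lemma every branch sends the point
    \<open>r / 2 * w\<close> into the disc of radius \<open>r\<close>. There the \<open>n\<close>-th
    iterate contracts by \<open>c ^ n\<close>, yet it must give back
    \<open>r / 2 * w\<close>.\<close>
  define w where "w = min (1/2) (r / (2 * (\<bar>M\<bar> + 1)))"
  have w: "0 < w" "w < 1" "w * (\<bar>M\<bar> + 1) < r"
  proof -
    show "0 < w" "w < 1" using rc(1) by (auto simp: w_def)
    have "w \<le> r / (2 * (\<bar>M\<bar> + 1))" by (simp add: w_def)
    then have "w * (\<bar>M\<bar> + 1) \<le> r / (2 * (\<bar>M\<bar> + 1)) * (\<bar>M\<bar> + 1)" by (intro mult_right_mono) auto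
    also have "\<dots> = r / 2" by (simp add: divide_simps)
    finally show "w * (\<bar>M\<bar> + 1) < r" using rc(1) by simp
  qed
  have "r / 2 * w \<le> c ^ n * r" for n
  proof -
    obtain h where h: "h holomorphic_on ball 0 r" "h 0 = 0" "\<forall>z\<in>ball 0 r. (f ^^ n) (h z) = z"
      using ex by blast
    have bd: "norm (h z) \<le> M" if "norm z \<le> r / 2" for z
      using that rc(1) h(2) by (intro M[OF h(1)] avoid[OF h(1) h(3)]) auto
    \<comment> \<open>Normalised for Schwarz's lemma; dividing by \<open>\<bar>M\<bar> + 1\<close>
      makes the bound by 1 strict.\<close>
    define k where "k = (\<lambda>u. h (of_real (r / 2) * u) / of_real (\<bar>M\<bar> + 1))"
    have inb: "of_real (r / 2) * u \<in> ball 0 r" "norm (of_real (r / 2) * u) \<le> r / 2"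
      if "norm u < 1" for u :: complex
    proof -
      have "norm (of_real (r / 2) * u) = r / 2 * norm u" using rc(1) by (simp add: norm_mult)
      also have "\<dots> \<le> r / 2 * 1" using that rc(1) by (intro mult_left_mono) auto
      finally show "norm (of_real (r / 2) * u) \<le> r / 2" by simp
      then show "of_real (r / 2) * u \<in> ball 0 r" using rc(1) by simp
    qed
    have "k holomorphic_on ball 0 1"
      unfolding k_def
      by (intro holomorphic_intros holomorphic_on_compose_gen[OF _ h(1), unfolded o_def])
        (use inb(1) in \<open>auto simp: complex_eq_iff\<close>)
    moreover have "k 0 = 0" by (simp add: k_def h(2))
    moreover have "norm (k u) < 1" if "norm u < 1" for u
    proof -
      have "norm (k u) = norm (h (of_real (r / 2) * u)) / (\<bar>M\<bar> + 1)"
        unfolding k_def norm_divide norm_of_real by simp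
      also have "\<dots> < 1" using bd[OF inb(2)[OF that]] by simp
      finally show ?thesis .
    qed
    moreover have wn: "norm (of_real w :: complex) < 1" using w by simp
    ultimately have "norm (k (of_real w)) \<le> norm (of_real w :: complex)"
      by (rule Schwarz_Lemma(1))
    then have "norm (h (of_real (r / 2) * of_real w)) \<le> w * (\<bar>M\<bar> + 1)"
      using w unfolding k_def norm_divide norm_of_real by (simp add: field_simps)
    then have lt: "norm (h (of_real (r / 2) * of_real w)) < r" using w by linarith
    have "r / 2 * w = norm ((f ^^ n) (h (of_real (r / 2) * of_real w)))"
      using h(3) inb(1)[OF wn] rc(1) w by (simp add: norm_mult)
    also have "\<dots> \<le> c ^ n * norm (h (of_real (r / 2) * of_real w))" by (rule rc(4)[OF lt])
    also have "\<dots> \<le> c ^ n * r" using lt rc(2) by (intro mult_left_mono) auto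
    finally show ?thesis .
  qed
  moreover have "(\<lambda>n. c ^ n * r) \<longlonglongrightarrow> 0 * r"
    using rc by (intro tendsto_intros LIMSEQ_power_zero) auto
  ultimately have "r / 2 * w \<le> 0 * r"
    by (intro tendsto_lowerbound[where F = sequentially and f = "\<lambda>n. c ^ n * r"]) auto
  then show False using rc(1) w(1) by (simp add: mult_le_0_iff)
qed

subsection \<open>The Fatou set is the basin\<close>

text \<open>The inverse branches \<open>h n\<close> taking \<open>w n\<close> back to
  \<open>z0\<close> form a normal family; let \<open>H\<close> be a limit. For a basin point
  \<open>a\<close> of \<open>B\<close> the iterates at \<open>h n a\<close> always equal
  \<open>a\<close>. If \<open>H\<close> were constant, they would tend to \<open>w'\<close>, which
  is not in the basin; otherwise \<open>H a\<close> lies in the basin and they tend to 0, which is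
  not in \<open>B\<close>.\<close>

lemma no_finite_limit:
  assumes z0: "z0 \<notin> basin" and \<rho>: "0 < \<rho>" and r: "strict_mono r"
    and ul: "uniform_limit (cball z0 \<rho>) (\<lambda>n. f ^^ r n) g sequentially"
  shows False
proof -
  define P where "P = insert 0 (range (\<lambda>j. (f ^^ j) lam)) \<union> insert 0 (range (\<lambda>j. (f ^^ j) (- lam)))"
  have lamb: "lam \<in> basin" "- lam \<in> basin"
    using critical_value_in_immediate_basin immediate_basin_subset minus_in_basin_iff by auto
  have "compact P" unfolding P_def
    by (intro compact_Un compact_sequence_with_limit) (use lamb in \<open>auto simp: basin_def\<close>)
  have Pb: "P \<subseteq> basin" using lamb by (auto simp: P_def zero_in_basin funpow_in_basin_iff)
  have gcont: "continuous_on (cball z0 \<rho>) g"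
    by (rule uniform_limit_theorem[OF _ ul]) (auto intro: always_eventually continuous_funpow)
  define w' where "w' = g z0"
  have wlim: "(\<lambda>n. (f ^^ r n) z0) \<longlonglongrightarrow> w'"
    unfolding w'_def using \<rho> by (intro tendsto_uniform_limitI[OF ul]) auto
  have w'b: "w' \<notin> basin"
  proof -
    have "closed (- basin)" using open_basin by (simp add: closed_Compl)
    then have "w' \<in> - basin"
      by (rule closed_sequentially[OF _ _ wlim]) (use z0 in \<open>auto simp: funpow_in_basin_iff\<close>)
    then show ?thesis by simp
  qed
  \<comment> \<open>The nearest point of the closed critical orbits: the disc \<open>B\<close> of
    radius \<open>d\<close> avoids \<open>P\<close>, but has the basin point \<open>p\<close> on its
    boundary and hence meets the open basin.\<close>
  obtain p where p: "p \<in> P" "\<And>y. y \<in> P \<Longrightarrow> dist w' p \<le> dist w' y"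
    using distance_attains_inf[of P w'] compact_imp_closed[OF \<open>compact P\<close>] by (auto simp: P_def)
  define d where "d = dist w' p"
  have d: "0 < d" using p Pb w'b by (auto simp: d_def)
  define B where "B = ball w' d"
  have BP: "y \<notin> P" if "y \<in> B" for y using p(2)[of y] that by (auto simp: B_def d_def)
  have B: "open B" "connected B" "contractible B" "w' \<in> B"
    using d by (auto simp: B_def intro: convex_imp_contractible)
  obtain a where a: "a \<in> basin" "a \<in> B"
  proof -
    have "p \<in> basin \<inter> closure B" using p(1) Pb d by (auto simp: B_def d_def)
    then have "basin \<inter> B \<noteq> {}" using open_Int_closure_eq_empty[OF open_basin] by blast
    then show thesis using that by blast
  qed
  have "a \<noteq> 0" using BP[OF a(2)] by (auto simp: P_def)
  have "\<forall>\<^sub>F n in sequentially. dist ((f ^^ r n) z0) w' < d / 4"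
    using wlim d by (intro tendstoD) auto
  then obtain N where N: "\<And>n. n \<ge> N \<Longrightarrow> dist ((f ^^ r n) z0) w' < d / 4"
    by (auto simp: eventually_sequentially)
  define s where "s = (\<lambda>n. r (n + N))"
  define w where "w = (\<lambda>n. (f ^^ s n) z0)"
  have s: "strict_mono s" using r by (auto simp: s_def strict_mono_def)
  have ws: "w \<longlonglongrightarrow> w'" unfolding w_def s_def by (rule LIMSEQ_ignore_initial_segment[OF wlim])
  have uls: "uniform_limit (cball z0 \<rho>) (\<lambda>n. f ^^ s n) g sequentially"
    unfolding s_def by (rule filterlim_compose[OF ul]) (simp add: filterlim_add_const_nat_at_top)
  have wd: "dist (w n) w' < d / 4" for n using N[of "n + N"] by (simp add: w_def s_def)
  have wB: "w n \<in> B" for n using wd[of n] d by (simp add: B_def dist_commute)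
  have avoid: "h z \<noteq> lam \<and> h z \<noteq> - lam" if "\<forall>z\<in>B. (f ^^ m) (h z) = z" "z \<in> B" for h m z
  proof -
    have "(f ^^ m) lam \<in> P" "(f ^^ m) (- lam) \<in> P" by (auto simp: P_def)
    then show ?thesis using that BP by metis
  qed
  have "\<exists>h. h holomorphic_on B \<and> h (w n) = z0 \<and> (\<forall>z\<in>B. (f ^^ s n) (h z) = z)" for n
    by (rule inverse_branch[where Q = UNIV]) (use avoid B wB in \<open>auto simp: w_def\<close>)
  then obtain h where h: "\<And>n. h n holomorphic_on B" "\<And>n. h n (w n) = z0"
    "\<And>n z. z \<in> B \<Longrightarrow> (f ^^ s n) (h n z) = z"
    by metis
  have hav: "h n z \<noteq> lam \<and> h n z \<noteq> - lam" if "z \<in> B" for n z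
    using avoid[of "s n" "h n" z] h(3) that by blast
  have lamne: "lam \<noteq> - lam" using lam_nz by (auto simp: eq_neg_iff_add_eq_0)
  \<comment> \<open>The value \<open>z0\<close> is known at the moving centre \<open>w n\<close>,
    within \<open>d / 4\<close> of \<open>w'\<close>. The disc of radius \<open>3 / 4 * d\<close>
    about \<open>w n\<close> lies in \<open>B\<close>, and \<open>w'\<close> is at most 1/3 of its
    radius away; this bounds \<open>h n\<close> at the fixed centre \<open>w'\<close>.\<close>
  obtain M where M: "\<And>h c \<rho> z. \<lbrakk>h holomorphic_on ball c \<rho>; norm (h c) \<le> norm z0; 0 < \<rho>;
      \<And>w. w \<in> ball c \<rho> \<Longrightarrow> h w \<noteq> lam \<and> h w \<noteq> - lam; dist c z \<le> 1/3 * \<rho>\<rbrakk> \<Longrightarrow> norm (h z) \<le> M"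
    by (rule Schottky_ball[of lam "- lam" "1/3" "norm z0"]) (use lamne in auto)
  have hw': "norm (h n w') \<le> M" for n
  proof (rule M[of "h n" "w n" "3 / 4 * d"])
    have sub: "ball (w n) (3 / 4 * d) \<subseteq> B"
    proof
      fix y assume "y \<in> ball (w n) (3 / 4 * d)"
      then show "y \<in> B" using wd[of n] dist_triangle[of w' y "w n"] by (simp add: B_def dist_commute)
    qed
    show "h n holomorphic_on ball (w n) (3 / 4 * d)" using h(1) sub holomorphic_on_subset by blast
    show "h n u \<noteq> lam \<and> h n u \<noteq> - lam" if "u \<in> ball (w n) (3 / 4 * d)" for u
      using hav sub that by blast
  qed (use d wd[of n] h(2) in auto)
  have bounded: "\<exists>C. \<forall>k\<in>range h. \<forall>z\<in>K. norm (k z) \<le> C" if K: "compact K" "K \<subseteq> B" for K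
  proof -
    obtain e where e: "0 \<le> e" "e < d" "K \<subseteq> cball w' e"
    proof (cases "K = {}")
      case False
      obtain x where x: "x \<in> K" "\<And>y. y \<in> K \<Longrightarrow> dist w' y \<le> dist w' x"
        using distance_attains_sup[OF K(1) False] by blast
      then show thesis using that[of "dist w' x"] K(2) by (auto simp: B_def subset_iff)
    qed (use d in auto)
    define t where "t = e / d"
    have t: "0 \<le> t" "t < 1" using e d by (auto simp: t_def)
    obtain C where C: "\<And>h c \<rho> z. \<lbrakk>h holomorphic_on ball c \<rho>; norm (h c) \<le> M; 0 < \<rho>;
      \<And>w. w \<in> ball c \<rho> \<Longrightarrow> h w \<noteq> lam \<and> h w \<noteq> - lam; dist c z \<le> t * \<rho>\<rbrakk> \<Longrightarrow> norm (h z) \<le> C"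
      by (rule Schottky_ball[of lam "- lam" t M]) (use lamne t in auto)
    have "norm (h n z) \<le> C" if "z \<in> K" for n z
      by (rule C[of "h n" w' d]) (use h(1) hw' d hav that e in \<open>auto simp: B_def t_def\<close>)
    then show ?thesis by blast
  qed
  have hol: "\<And>k. k \<in> range h \<Longrightarrow> k holomorphic_on B" using h(1) by auto
  obtain H q where H: "H holomorphic_on B" "strict_mono (q :: nat \<Rightarrow> nat)"
    "\<And>x. x \<in> B \<Longrightarrow> (\<lambda>n. h (q n) x) \<longlonglongrightarrow> H x"
    "\<And>K. compact K \<Longrightarrow> K \<subseteq> B \<Longrightarrow> uniform_limit K (h \<circ> q) H sequentially"
    by (rule Montel[OF B(1) hol bounded subset_refl]) (assumption+, rule that)
  have qinf: "filterlim q at_top sequentially" using H(2) by (rule filterlim_subseq)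
  have sqinf: "filterlim (\<lambda>n. s (q n)) at_top sequentially"
    using filterlim_compose[OF filterlim_subseq[OF s] qinf] by simp
  have Hw': "H w' = z0"
  proof -
    have sub: "cball w' (d / 4) \<subseteq> B" using d by (auto simp: B_def)
    have "(\<lambda>n. (h \<circ> q) n (w (q n))) \<longlonglongrightarrow> H w'"
    proof (rule uniform_limit_tendsto_moving[OF H(4)[OF compact_cball sub]])
      show "continuous_on (cball w' (d / 4)) H"
        using H(1) sub by (meson holomorphic_on_imp_continuous_on holomorphic_on_subset)
      show "\<forall>\<^sub>F n in sequentially. w (q n) \<in> cball w' (d / 4)"
        using wd by (intro always_eventually allI) (simp add: dist_commute less_imp_le)
      show "(\<lambda>n. w (q n)) \<longlonglongrightarrow> w'" by (rule filterlim_compose[OF ws qinf])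
    qed (use d in auto)
    then show ?thesis using h(2) by (simp add: LIMSEQ_const_iff)
  qed
  have nonconst: "\<not> H constant_on B"
  proof
    assume "H constant_on B"
    then have Ha: "H a = z0" using Hw' a(2) B(4) unfolding constant_on_def by metis
    have lim: "(\<lambda>n. h (q n) a) \<longlonglongrightarrow> z0" using H(3)[OF a(2)] Ha by simp
    have "(\<lambda>n. (f ^^ s (q n)) (h (q n) a)) \<longlonglongrightarrow> g z0"
    proof (rule uniform_limit_tendsto_moving[OF _ gcont _ lim])
      show "uniform_limit (cball z0 \<rho>) (\<lambda>n. f ^^ s (q n)) g sequentially"
        by (rule filterlim_compose[OF uls qinf])
      have "\<forall>\<^sub>F n in sequentially. h (q n) a \<in> ball z0 \<rho>"
        using topological_tendstoD[OF lim open_ball, of z0 \<rho>] \<rho> by simp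
      then show "\<forall>\<^sub>F n in sequentially. h (q n) a \<in> cball z0 \<rho>"
        by eventually_elim auto
    qed (use \<rho> in auto)
    then have "a = w'" using h(3)[OF a(2)] by (simp add: LIMSEQ_const_iff w'_def)
    then show False using a(1) w'b by simp
  qed
  \<comment> \<open>Near \<open>a\<close> the branches take values in the basin only. If
    \<open>H a\<close> were outside, \<open>h (q n) z - H a\<close> would have no zeros, and by
    Hurwitz neither would its nonconstant limit, which vanishes at \<open>a\<close>.\<close>
  have Hab: "H a \<in> basin"
  proof (rule ccontr)
    assume Hn: "H a \<notin> basin"
    have "open (basin \<inter> B)" using open_basin B(1) by blast
    then obtain e where e: "0 < e" "ball a e \<subseteq> basin \<inter> B"
      using a openE by (metis IntI)
    have nc: "\<not> (\<lambda>z. H z - H a) constant_on ball a e"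
    proof
      assume "(\<lambda>z. H z - H a) constant_on ball a e"
      then have "H constant_on ball a e" unfolding constant_on_def by (metis diff_add_cancel)
      moreover have "a islimpt ball a e" using e(1) by (simp add: islimpt_ball)
      ultimately have "H constant_on B"
        using analytic_continuation'[OF H(1) B(1,2), of "ball a e" a] e(2) a(2) by blast
      then show False using nonconst by simp
    qed
    have "H a - H a \<noteq> 0"
    proof (rule Hurwitz_no_zeros[where S = "ball a e" and \<F> = "\<lambda>n z. h (q n) z - H a"
            and g = "\<lambda>z. H z - H a", OF _ _ _ _ _ nc])
      show "(\<lambda>z. h (q n) z - H a) holomorphic_on ball a e" for n
        using h(1)[of "q n"] e(2) by (intro holomorphic_intros) (auto intro: holomorphic_on_subset)
      show "(\<lambda>z. H z - H a) holomorphic_on ball a e"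
        using H(1) e(2) by (intro holomorphic_intros) (auto intro: holomorphic_on_subset)
      show "uniform_limit K (\<lambda>n z. h (q n) z - H a) (\<lambda>z. H z - H a) sequentially"
        if "compact K" "K \<subseteq> ball a e" for K
        using H(4)[OF that(1)] that(2) e(2) by (intro uniform_limit_intros) (auto simp: o_def)
      show "h (q n) z - H a \<noteq> 0" if "z \<in> ball a e" for n z
      proof -
        have "z \<in> basin" "z \<in> B" using that e(2) by auto
        then have "h (q n) z \<in> basin" using h(3)[of z "q n"] funpow_in_basin_iff by metis
        then show ?thesis using Hn by auto
      qed
    qed (use e in auto)
    then show False by simp
  qed
  obtain e where e: "0 < e" "cball (H a) e \<subseteq> basin"
    using open_basin Hab open_contains_cball by blast
  have lim: "(\<lambda>n. h (q n) a) \<longlonglongrightarrow> H a" by (rule H(3)[OF a(2)])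
  have "(\<lambda>n. (f ^^ s (q n)) (h (q n) a)) \<longlonglongrightarrow> 0"
  proof (rule uniform_limit_tendsto_moving[OF _ continuous_on_const _ lim])
    show "uniform_limit (cball (H a) e) (\<lambda>n. f ^^ s (q n)) (\<lambda>_. 0) sequentially"
      by (rule filterlim_compose[OF uniform_limit_basin[OF compact_cball e(2)] sqinf])
    have "\<forall>\<^sub>F n in sequentially. h (q n) a \<in> ball (H a) e"
      using topological_tendstoD[OF lim open_ball, of "H a" e] e(1) by simp
    then show "\<forall>\<^sub>F n in sequentially. h (q n) a \<in> cball (H a) e"
      by eventually_elim auto
  qed (use e(1) in auto)
  then have "a = 0" using h(3)[OF a(2)] by (simp add: LIMSEQ_const_iff)
  with \<open>a \<noteq> 0\<close> show False by simp
qed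

section \<open>Escape to infinity\<close>

lemma has_field_derivative_f: "(f has_field_derivative lam * cos z) (at z)"
  unfolding f_def by (auto intro!: derivative_eq_intros)

lemma deriv_funpow_Suc: "deriv (f ^^ Suc n) z = lam * cos ((f ^^ n) z) * deriv (f ^^ n) z"
proof -
  have "((f ^^ n) has_field_derivative deriv (f ^^ n) z) (at z)"
    using holomorphic_funpow[of n UNIV] by (simp add: holomorphic_derivI)
  then have "((f \<circ> f ^^ n) has_field_derivative lam * cos ((f ^^ n) z) * deriv (f ^^ n) z) (at z)"
    by (rule DERIV_chain[OF has_field_derivative_f])
  then show ?thesis by (simp add: DERIV_imp_deriv)
qed

lemma no_infinite_limit:
  assumes \<rho>: "0 < \<rho>"
    and esc: "\<And>B. \<forall>\<^sub>F n in sequentially. \<forall>z\<in>cball z0 \<rho>. B \<le> norm ((f ^^ n) z)"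
  shows False
proof -
  obtain N where N: "\<And>n z. n \<ge> N \<Longrightarrow> z \<in> cball z0 \<rho> \<Longrightarrow> 3 \<le> norm ((f ^^ n) z)"
    using esc[of 3] unfolding eventually_sequentially by blast
  have z0: "z0 \<in> cball z0 \<rho>" using \<rho> by simp
  have nb: "z0 \<notin> basin"
  proof
    assume "z0 \<in> basin"
    then have "(\<lambda>n. norm ((f ^^ n) z0)) \<longlonglongrightarrow> norm (0 :: complex)"
      unfolding basin_def by (intro tendsto_norm) simp
    moreover have "\<forall>\<^sub>F n in sequentially. 3 \<le> norm ((f ^^ n) z0)"
      using N[OF _ z0] by (auto simp: eventually_sequentially)
    ultimately have "3 \<le> norm (0 :: complex)" by (rule tendsto_lowerbound) simp
    then show False by simp
  qed
  \<comment> \<open>A zero of the cosine would make the next iterate a critical value, which is in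
    the basin.\<close>
  have cos_nz: "cos ((f ^^ n) z0) \<noteq> 0" for n
  proof
    assume "cos ((f ^^ n) z0) = 0"
    then have "(sin ((f ^^ n) z0))\<^sup>2 = 1" using sin_cos_squared_add[of "(f ^^ n) z0"] by simp
    then have "(f ^^ Suc n) z0 = lam \<or> (f ^^ Suc n) z0 = - lam"
      by (auto simp: power2_eq_1_iff f_def)
    then have "(f ^^ Suc n) z0 \<in> basin"
      using critical_value_in_immediate_basin immediate_basin_subset minus_in_basin_iff by auto
    then show False using nb funpow_in_basin_iff by blast
  qed
  define D where "D = (\<lambda>n. norm (deriv (f ^^ n) z0))"
  have D_Suc: "D (Suc n) = norm (lam * cos ((f ^^ n) z0)) * D n" for n
    unfolding D_def deriv_funpow_Suc by (simp add: norm_mult)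
  have D_pos: "0 < D n" for n
  proof (induction n)
    case 0
    have "(f ^^ 0) = (\<lambda>z. z)" by auto
    then show ?case by (simp add: D_def)
  next
    case (Suc n)
    then show ?case using cos_nz[of n] lam_nz by (simp add: D_Suc norm_mult)
  qed
  \<comment> \<open>From \<open>(lam * sin u)\<^sup>2 + (lam * cos u)\<^sup>2 = lam\<^sup>2\<close>
    the cosine term has squared modulus at least 9 - 1, more than 4.\<close>
  have expand: "2 \<le> norm (lam * cos ((f ^^ n) z0))" if "n \<ge> N" for n
  proof -
    define u where "u = (f ^^ n) z0"
    have "3 \<le> norm (lam * sin u)" using N[of "Suc n" z0] z0 that by (simp add: u_def f_def)
    then have "3\<^sup>2 \<le> (norm (lam * sin u))\<^sup>2" by (intro power_mono) auto
    also have "lam\<^sup>2 = (lam * sin u)\<^sup>2 + (lam * cos u)\<^sup>2"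
      by (simp add: power_mult_distrib flip: distrib_left)
    then have "(lam * sin u)\<^sup>2 = lam\<^sup>2 - (lam * cos u)\<^sup>2" by simp
    then have "(norm (lam * sin u))\<^sup>2 \<le> (norm lam)\<^sup>2 + (norm (lam * cos u))\<^sup>2"
      by (metis norm_power norm_triangle_ineq4)
    also have "(norm lam)\<^sup>2 \<le> 1" using lam1 by (simp add: power_le_one)
    finally have "2\<^sup>2 \<le> (norm (lam * cos u))\<^sup>2" by simp
    then show ?thesis unfolding u_def by (rule power2_le_imp_le) simp
  qed
  have grow: "2 ^ m * D N \<le> D (N + m)" for m
  proof (induction m)
    case (Suc m)
    have "2 * (2 ^ m * D N) \<le> norm (lam * cos ((f ^^ (N + m)) z0)) * D (N + m)"
      using Suc expand[of "N + m"] D_pos[of N] by (intro mult_mono) auto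
    then show ?case by (simp add: D_Suc mult_ac)
  qed simp
  \<comment> \<open>Bloch's theorem gives a disc of radius \<open>\<rho>\<close> times the
    derivative over 12, and 48 = 4 * 12. Radius 4 exceeds pi, so a horizontal segment of length pi
    from the centre fits.\<close>
  obtain m where m: "48 / (\<rho> * D N) < 2 ^ m" using real_arch_pow[of 2] by auto
  have "4 \<le> \<rho> * norm (deriv (f ^^ (N + m)) z0) / 12"
  proof -
    have "48 < \<rho> * (2 ^ m * D N)" using m \<rho> D_pos[of N] by (simp add: field_simps)
    also have "\<dots> \<le> \<rho> * D (N + m)" using grow[of m] \<rho> by (intro mult_left_mono) auto
    finally show ?thesis by (simp add: D_def)
  qed
  then obtain b where b: "ball b 4 \<subseteq> (f ^^ (N + m)) ` ball z0 \<rho>"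
    using Bloch[OF holomorphic_funpow \<rho>] by blast
  \<comment> \<open>Since \<open>f\<close> is odd under the shift by \<open>\<pi>\<close>, it takes a real value in every large disc.\<close>
  have "\<exists>t. 0 \<le> t \<and> t \<le> pi \<and> Im (f (b + of_real t)) = 0"
  proof -
    have cont: "continuous_on {0..pi} (\<lambda>t. Im (f (b + of_real t)))"
      unfolding f_def by (intro continuous_intros)
    have "Im (f (b + of_real pi)) = - Im (f (b + of_real 0))"
      by (simp add: f_def sin_add)
    then show ?thesis
      using IVT'[OF _ _ _ cont, of 0] IVT2'[OF _ _ _ cont, of 0]
      by (cases "Im (f (b + of_real 0)) \<le> 0") auto
  qed
  then obtain t where t: "0 \<le> t" "t \<le> pi" "Im (f (b + of_real t)) = 0" by blast
  have "b + of_real t \<in> ball b 4" using t pi_less_4 by (simp add: dist_norm)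
  then obtain z where z: "z \<in> ball z0 \<rho>" "(f ^^ (N + m)) z = b + of_real t" using b by (metis imageE subsetD)
  have "f (b + of_real t) = of_real (Re (f (b + of_real t)))" using t(3) by (simp add: complex_eq_iff)
  then have "norm (sin (f (b + of_real t))) \<le> 1"
    by (metis abs_sin_le_one norm_of_real sin_of_real)
  then have "norm (f (f (b + of_real t))) \<le> norm lam * 1"
    unfolding f_def[of "f _"] norm_mult by (intro mult_left_mono) auto
  then have "norm ((f ^^ Suc (Suc (N + m))) z) \<le> 1" using z lam1 by simp
  moreover have "3 \<le> norm ((f ^^ Suc (Suc (N + m))) z)" using z by (intro N) auto
  ultimately show False by simp
qed

text \<open>Normality speaks of subsequences, while the derivative estimate needs consecutive
  iterates. As finite limits are excluded, every subsequence has a further one escaping to infinity,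
  and therefore so does the full sequence.\<close>

lemma fatou_set_subset_basin: "fatou_set f \<subseteq> basin"
proof
  fix z0 assume "z0 \<in> fatou_set f"
  then obtain V where V: "open V" "z0 \<in> V" and norm: "normal_family_on V (\<lambda>n. f ^^ n)"
    unfolding fatou_set_def by blast
  obtain \<rho> where \<rho>: "0 < \<rho>" "cball z0 \<rho> \<subseteq> V" using V open_contains_cball by blast
  show "z0 \<in> basin"
  proof (rule ccontr)
    assume nb: "z0 \<notin> basin"
    have sub: "\<exists>r. strict_mono r \<and> (\<forall>B. \<forall>\<^sub>F n in sequentially. \<forall>z\<in>cball z0 \<rho>. B \<le> norm ((f ^^ k (r n)) z))"
      if k: "strict_mono k" for k :: "nat \<Rightarrow> nat"
    proof -
      obtain r where r: "strict_mono r"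
        and alt: "(\<exists>g. \<forall>K. compact K \<and> K \<subseteq> V \<longrightarrow> uniform_limit K (\<lambda>n. f ^^ k (r n)) g sequentially)
         \<or> (\<forall>K. compact K \<and> K \<subseteq> V \<longrightarrow> (\<forall>B. \<forall>\<^sub>F n in sequentially. \<forall>z\<in>K. B \<le> norm ((f ^^ k (r n)) z)))"
        using norm[unfolded normal_family_on_def, rule_format, of k] by (elim exE conjE) (rule that)
      have "strict_mono (\<lambda>n. k (r n))" using k r by (simp add: strict_mono_def)
      note no_lim = no_finite_limit[OF nb \<rho>(1) this]
      show ?thesis using alt
      proof (elim disjE exE)
        fix g assume "\<forall>K. compact K \<and> K \<subseteq> V \<longrightarrow> uniform_limit K (\<lambda>n. f ^^ k (r n)) g sequentially"
        from this[rule_format, of "cball z0 \<rho>"] show ?thesis using no_lim[of g] \<rho>(2) by simp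
      next
        assume "\<forall>K. compact K \<and> K \<subseteq> V \<longrightarrow>
          (\<forall>B. \<forall>\<^sub>F n in sequentially. \<forall>z\<in>K. B \<le> norm ((f ^^ k (r n)) z))"
        from this[rule_format, of "cball z0 \<rho>"] show ?thesis
          using r \<rho>(2) by (intro exI[of _ r]) simp
      qed
    qed
    have "\<forall>\<^sub>F n in sequentially. \<forall>z\<in>cball z0 \<rho>. B \<le> norm ((f ^^ n) z)" for B
    proof (rule ccontr)
      define S where "S = {n. \<not> (\<forall>z\<in>cball z0 \<rho>. B \<le> norm ((f ^^ n) z))}"
      assume "\<not> (\<forall>\<^sub>F n in sequentially. \<forall>z\<in>cball z0 \<rho>. B \<le> norm ((f ^^ n) z))"
      then have inf: "infinite S"
        by (simp add: S_def eventually_cofinite flip: cofinite_eq_sequentially)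
      have "strict_mono (enumerate S)" using inf by (simp add: strict_mono_enumerate)
      then obtain r where
        "\<forall>\<^sub>F n in sequentially. \<forall>z\<in>cball z0 \<rho>. B \<le> norm ((f ^^ enumerate S (r n)) z)"
        using sub by blast
      then obtain n where "\<forall>z\<in>cball z0 \<rho>. B \<le> norm ((f ^^ enumerate S (r n)) z)"
        unfolding eventually_sequentially by blast
      moreover have "enumerate S (r n) \<in> S" using enumerate_in_set[OF inf] .
      ultimately show False by (simp add: S_def)
    qed
    then show False using no_infinite_limit[OF \<rho>(1)] by blast
  qed
qed

lemma fatou_set_eq_basin: "fatou_set f = basin"
  using fatou_set_subset_basin basin_subset_fatou_set by blast

subsection \<open>Connectedness and simple connectedness of the basin\<close>

text \<open>Away from its critical values \<open>f\<close> is a covering, so the image of a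
  component is open and relatively closed in the connected set \<open>E\<close>.\<close>

lemma f_component_covers:
  assumes z: "f z \<in> immediate_basin"
  shows "immediate_basin - {lam, - lam} \<subseteq> f ` connected_component_set basin z"
proof -
  define W where "W = connected_component_set basin z"
  define E where "E = immediate_basin - {lam, - lam}"
  have zb: "z \<in> basin" using z immediate_basin_subset f_in_basin_iff by blast
  have W: "open W" "connected W" "W \<subseteq> basin" "z \<in> W"
    using zb open_basin by (auto simp: W_def open_connected_component connected_component_subset)
  have fW: "f ` W \<subseteq> immediate_basin"
  proof (rule connected_subset_immediate_basin)
    show "connected (f ` W)"
      by (intro connected_continuous_image holomorphic_on_imp_continuous_on holomorphic_f W)
    show "f ` W \<subseteq> basin" using W(3) f_in_basin_iff by blast
  qed (use W(4) z in auto)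
  have "f (of_real (pi / 2)) \<noteq> f 0" using lam_nz by (simp add: f_def)
  then have "\<not> f constant_on UNIV" unfolding constant_on_def by (metis UNIV_I)
  then have op: "open (f ` W)"
    using open_mapping_thm[OF holomorphic_f open_UNIV connected_UNIV W(1)] by simp
  have E: "open E" "connected E"
    unfolding E_def
    by (auto intro!: open_Diff finite_imp_closed connected_open_delete_finite
        simp: open_immediate_basin connected_immediate_basin)
  have op': "open (E - f ` W)"
    unfolding open_contains_ball
  proof
    fix w assume w: "w \<in> E - f ` W"
    then obtain e where e: "0 < e" "ball w e \<subseteq> E" using E(1) open_contains_ball by blast
    have "ball w e \<inter> f ` W = {}"
    proof (rule ccontr)
      assume "ball w e \<inter> f ` W \<noteq> {}"
      then obtain u where u: "u \<in> W" "f u \<in> ball w e" by blast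
      have "\<exists>g. g holomorphic_on ball w e \<and> g (f u) = u \<and> (\<forall>y\<in>ball w e. f (g y) = id y)"
        by (rule lift_through_f) (use e u in \<open>auto simp: E_def id_def intro!: convex_imp_contractible\<close>)
      then obtain g where g: "g holomorphic_on ball w e" "g (f u) = u" "\<And>y. y \<in> ball w e \<Longrightarrow> f (g y) = y"
        by auto
      have "g ` ball w e \<subseteq> connected_component_set basin u"
      proof (rule connected_component_maximal)
        show "u \<in> g ` ball w e" using u(2) g(2) by force
        show "connected (g ` ball w e)"
          by (intro connected_continuous_image holomorphic_on_imp_continuous_on g(1)) simp
        show "g ` ball w e \<subseteq> basin"
        proof
          fix x assume "x \<in> g ` ball w e"
          then have "f x \<in> ball w e" using g(3) by auto
          then have "f x \<in> basin" using e(2) immediate_basin_subset by (auto simp: E_def)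
          then show "x \<in> basin" by (simp add: f_in_basin_iff)
        qed
      qed
      moreover have "connected_component_set basin u = W"
        using u(1) unfolding W_def by (metis connected_component_eq)
      moreover have "w \<in> ball w e" using e(1) by simp
      ultimately have "g w \<in> W" "f (g w) = w" using g(3) by blast+
      then show False using w by (metis DiffD2 imageI)
    qed
    then show "\<exists>e>0. ball w e \<subseteq> E - f ` W" using e by blast
  qed
  have ne: "f ` W \<inter> E \<noteq> {}"
  proof
    assume "f ` W \<inter> E = {}"
    then have "f ` W \<subseteq> {lam, - lam}" using fW by (auto simp: E_def)
    then have "finite (f ` W)" by (rule finite_subset) simp
    then show False using op W(4) finite_imp_not_open by blast
  qed
  have "E \<subseteq> f ` W"
    using connectedD[OF E(2) op op'] ne by blast
  then show ?thesis by (simp add: E_def W_def)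
qed

text \<open>The component contains a preimage of \<open>lam * (1 - s)\<close>, a regular value close
  to \<open>lam\<close>. Letting the sine grow from \<open>1 - s\<close> to 1 gives an arc from it
  that \<open>f\<close> maps into a small disc about \<open>lam\<close>, so the arc stays in the
  component; it ends at \<open>c\<close>.\<close>

lemma component_contains_critical_point:
  assumes z: "f z \<in> immediate_basin"
  shows "\<exists>c \<in> connected_component_set basin z. sin c = 1"
proof -
  define W where "W = connected_component_set basin z"
  obtain e where e: "0 < e" "ball lam e \<subseteq> immediate_basin"
    using open_immediate_basin critical_value_in_immediate_basin open_contains_ball by blast
  define s where "s = min (1/2) (e/2)"
  have s: "0 < s" "s \<le> 1/2" "s < e" using e(1) by (auto simp: s_def)
  have near: "lam * of_real y \<in> ball lam e" if "1 - s \<le> y" "y \<le> 1" for y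
  proof -
    have "norm (lam - lam * of_real y) = norm lam * norm (of_real (1 - y) :: complex)"
      by (simp add: right_diff_distrib flip: norm_mult)
    also have "\<dots> = norm lam * (1 - y)" unfolding norm_of_real using that by simp
    also have "\<dots> \<le> 1 * s" using lam1 that by (intro mult_mono) auto
    finally show ?thesis using s by (simp add: dist_norm)
  qed
  have "lam * of_real (1 - s) \<noteq> lam" "lam * of_real (1 - s) \<noteq> - lam"
  proof -
    have "lam * of_real (1 - s) \<noteq> lam * of_real 1" "lam * of_real (1 - s) \<noteq> lam * of_real (- 1)"
      unfolding mult_cancel_left of_real_eq_iff using lam_nz s by auto
    then show "lam * of_real (1 - s) \<noteq> lam" "lam * of_real (1 - s) \<noteq> - lam" by simp_all
  qed
  moreover have "lam * of_real (1 - s) \<in> immediate_basin" using near[of "1 - s"] e(2) s by auto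
  ultimately have "lam * of_real (1 - s) \<in> f ` W"
    using f_component_covers[OF z] unfolding W_def by blast
  then obtain z' where z': "z' \<in> W" "f z' = lam * of_real (1 - s)" by auto
  define x where "x = arcsin (1 - s)"
  have x: "- (pi / 2) \<le> x" "x \<le> pi / 2" "sin x = 1 - s"
    unfolding x_def using s arcsin_bounded[of "1 - s"] by auto
  have "sin z' = sin (of_real x)"
    using z'(2) lam_nz unfolding sin_of_real x(3) by (simp add: f_def)
  then obtain n where n: "n \<in> \<int>"
      "z' = of_real x + of_real (2 * n * pi) \<or> z' = - of_real x + of_real ((2 * n + 1) * pi)"
    unfolding complex_sin_eq by blast
  \<comment> \<open>\<open>T\<close> is the inverse sine arc through \<open>z'\<close>: one of the
    two families of solutions of \<open>sin z = sin t\<close>.\<close>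
  have concl: "\<exists>c\<in>W. sin c = 1"
    if T: "continuous_on UNIV T" "\<And>t. sin (T t) = sin (of_real t)" and zT: "z' = T x" for T :: "real \<Rightarrow> complex"
  proof -
    have "T ` {x..pi/2} \<subseteq> basin"
    proof
      fix y assume "y \<in> T ` {x..pi/2}"
      then obtain t where t: "x \<le> t" "t \<le> pi / 2" "y = T t" by auto
      have "1 - s \<le> sin t" unfolding x(3)[symmetric] using t x by (intro sin_monotone_2pi_le) auto
      then have "f y \<in> ball lam e" using near[of "sin t"] by (simp add: f_def t(3) T(2) sin_of_real)
      then show "y \<in> basin" using e(2) immediate_basin_subset f_in_basin_iff by blast
    qed
    moreover have "connected (T ` {x..pi/2})"
      by (intro connected_continuous_image continuous_on_subset[OF T(1)]) auto
    moreover have "z' \<in> T ` {x..pi/2}" using zT x(2) by auto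
    ultimately have "T ` {x..pi/2} \<subseteq> connected_component_set basin z'"
      by (intro connected_component_maximal)
    also have "\<dots> = W" using z'(1) unfolding W_def by (metis connected_component_eq)
    finally have "T (pi / 2) \<in> W" using x(2) by auto
    moreover have "sin (T (pi / 2)) = 1" unfolding T(2) sin_of_real by simp
    ultimately show ?thesis by blast
  qed
  from n(2) have "\<exists>c\<in>W. sin c = 1"
  proof
    assume "z' = of_real x + of_real (2 * n * pi)"
    moreover have "sin (of_real t + of_real (2 * n * pi)) = sin (of_real t :: complex)" for t
      unfolding complex_sin_eq using n(1) by blast
    ultimately show ?thesis
      by (intro concl[of "\<lambda>t. of_real t + of_real (2 * n * pi)"]) (auto intro!: continuous_intros)
  next
    assume "z' = - of_real x + of_real ((2 * n + 1) * pi)"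
    moreover have "sin (- of_real t + of_real ((2 * n + 1) * pi)) = sin (of_real t :: complex)" for t
      unfolding complex_sin_eq using n(1) by blast
    ultimately show ?thesis
      by (intro concl[of "\<lambda>t. - of_real t + of_real ((2 * n + 1) * pi)"]) (auto intro!: continuous_intros)
  qed
  then show ?thesis by (simp add: W_def)
qed

section \<open>Translation invariance of the immediate basin\<close>

lemma immediate_basin_add_period:
  assumes step: "\<And>z. z \<in> immediate_basin \<Longrightarrow> z + a \<in> immediate_basin" and z: "z \<in> immediate_basin"
  shows "z + of_int j * a \<in> immediate_basin"
proof -
  have nat: "z + of_nat n * a \<in> immediate_basin" if "z \<in> immediate_basin" for n z
  proof (induction n)
    case (Suc n)
    then show ?case using step[OF Suc] by (simp add: algebra_simps)
  qed (use that in simp)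
  show ?thesis
  proof (cases j)
    case (nonneg n)
    then show ?thesis using nat[OF z] by simp
  next
    case (neg n)
    have "- (- z + of_nat (Suc n) * a) \<in> immediate_basin"
      by (intro minus_in_immediate_basin nat z)
    then show ?thesis by (simp add: neg algebra_simps)
  qed
qed

lemma immediate_basin_add_pi:
  assumes "z \<in> immediate_basin"
  shows "z + of_real pi \<in> immediate_basin"
proof -
  obtain c where c: "c \<in> immediate_basin" "sin c = 1"
    using component_contains_critical_point[of 0] zero_in_immediate_basin
    by (auto simp: immediate_basin_def)
  then obtain n :: int where n: "c = of_real (pi / 2 + 2 * of_int n * pi)"
    unfolding sin_eq_1_iff_complex by blast
  \<comment> \<open>The reflections in 0 and \<open>c\<close> compose to the translation by
    \<open>2 * c\<close>. As \<open>n\<close> is unknown, this is only some odd multiple of pi,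
    nonzero because \<open>4 * n + 1\<close> is odd.\<close>
  define p where "p = (4 * real_of_int n + 1) * pi"
  have p: "2 * c = of_real p" by (simp add: n p_def algebra_simps)
  have "4 * n + 1 \<noteq> 0" by presburger
  then have "4 * real_of_int n + 1 \<noteq> 0" by linarith
  then have "p \<noteq> 0" by (simp add: p_def)
  have refl: "2 * c - w \<in> immediate_basin" if "w \<in> immediate_basin" for w
  proof (rule immediate_basin_map[of "\<lambda>w. 2 * c - w" c])
    fix u assume "u \<in> basin"
    have "cos c = 0" using c(2) sin_cos_squared_add[of c] by simp
    then have "sin (2 * c - u) = sin u"
      using c(2) by (simp add: sin_diff sin_double cos_double)
    then show "2 * c - u \<in> basin" using basin_sin_cong \<open>u \<in> basin\<close> by blast
  qed (use c that in \<open>auto intro!: continuous_intros\<close>)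
  have "w + of_real p \<in> immediate_basin" if "w \<in> immediate_basin" for w
    using refl[OF minus_in_immediate_basin[OF that]] by (simp add: p add.commute)
  then have inv: "w + of_int j * of_real p \<in> immediate_basin" if "w \<in> immediate_basin" for w j
    using immediate_basin_add_period that by blast
  have "path_connected immediate_basin"
    using connected_immediate_basin open_immediate_basin by (simp add: connected_open_path_connected)
  \<comment> \<open>One such \<open>x\<close> suffices: translation by pi preserves the basin, so it
    preserves the component as soon as one of its points stays in it.\<close>
  then obtain x where "x \<in> immediate_basin" "x + of_real pi \<in> immediate_basin"
    using invariant_path_connected_meets_translate[OF _ zero_in_immediate_basin \<open>p \<noteq> 0\<close> inv, of pi] by blast
  then show ?thesis
  proof (rule immediate_basin_map[of "\<lambda>w. w + of_real pi" x, rotated 2])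
    fix u assume "u \<in> basin"
    have "f (u + of_real pi) = - f u" by (simp add: f_def sin_add)
    then show "u + of_real pi \<in> basin"
      using \<open>u \<in> basin\<close> f_in_basin_iff minus_in_basin_iff by metis
  qed (use assms in \<open>auto intro!: continuous_intros\<close>)
qed

text \<open>The component of \<open>z\<close> contains a solution of \<open>sin c' = 1\<close>. It
  differs from a solution in the immediate basin by a multiple of pi, so the two components
  coincide.\<close>

lemma f_in_immediate_basinD:
  assumes "f z \<in> immediate_basin"
  shows "z \<in> immediate_basin"
proof -
  obtain c n where c: "c \<in> immediate_basin" "c = of_real (pi / 2 + 2 * of_int n * pi)"
    using component_contains_critical_point[of 0] zero_in_immediate_basin
    unfolding sin_eq_1_iff_complex by (auto simp: immediate_basin_def)
  obtain c' n' where c': "c' \<in> connected_component_set basin z" "c' = of_real (pi / 2 + 2 * of_int n' * pi)"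
    using component_contains_critical_point[OF assms] unfolding sin_eq_1_iff_complex by blast
  have "c' = c + of_int (2 * (n' - n)) * of_real pi" by (simp add: c c' algebra_simps)
  then have "c' \<in> immediate_basin"
    using immediate_basin_add_period[OF immediate_basin_add_pi c(1)] by metis
  then have "connected_component_set basin z \<subseteq> immediate_basin"
    using c'(1) by (intro connected_subset_immediate_basin) (auto simp: connected_component_subset)
  moreover have "z \<in> basin" using assms immediate_basin_subset f_in_basin_iff by blast
  ultimately show ?thesis by (metis connected_component_refl mem_Collect_eq subsetD)
qed

lemma immediate_basin_eq_basin: "immediate_basin = basin"
proof
  show "basin \<subseteq> immediate_basin"
  proof
    fix z assume z: "z \<in> basin"
    obtain r c where rc: "0 < r" "0 < c" "c < 1" "\<And>n z. norm z < r \<Longrightarrow> norm ((f ^^ n) z) \<le> c ^ n * norm z"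
      and A: "ball 0 r \<subseteq> basin" "basin = (\<Union>n. (f ^^ n) -` ball 0 r)"
      by (rule basin_eq_UN) (rule that)
    have "ball 0 r \<subseteq> immediate_basin"
      by (rule connected_subset_immediate_basin[of _ 0])
        (use A(1) rc(1) zero_in_immediate_basin in auto)
    then obtain n where n: "(f ^^ n) z \<in> immediate_basin" using z A(2) by blast
    have "(f ^^ n) z \<in> immediate_basin \<Longrightarrow> z \<in> immediate_basin" for n
      by (induction n) (auto dest: f_in_immediate_basinD)
    then show "z \<in> immediate_basin" using n by blast
  qed
qed (rule immediate_basin_subset)

text \<open>A point with nonzero winding number lies inside a curve on which the iterates tend
  uniformly to 0; the maximum principle carries this convergence to the point, which is then in the
  basin.\<close>

lemma simply_connected_basin: "simply_connected basin"
  unfolding simply_connected_eq_winding_number_zero[OF open_basin]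
proof (intro conjI allI impI)
  show "connected basin" using connected_immediate_basin immediate_basin_eq_basin by simp
  fix g z assume g: "path g \<and> path_image g \<subseteq> basin \<and> pathfinish g = pathstart g \<and> z \<notin> basin"
  show "winding_number g z = 0"
  proof (rule ccontr)
    assume "winding_number g z \<noteq> 0"
    then have "z \<notin> outside (path_image g)" using g winding_number_zero_in_outside by blast
    moreover have "z \<notin> path_image g" using g by blast
    ultimately have z: "z \<in> inside (path_image g)" using inside_Un_outside[of "path_image g"] by blast
    have cg: "compact (path_image g)" using g by (simp add: compact_path_image)
    have fr: "frontier (inside (path_image g)) \<subseteq> path_image g"
      by (intro frontier_inside_subset compact_imp_closed cg)
    have ul: "uniform_limit (path_image g) (\<lambda>n. f ^^ n) (\<lambda>_. 0) sequentially"
      using g cg by (intro uniform_limit_basin) auto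
    have "(\<lambda>n. (f ^^ n) z) \<longlonglongrightarrow> 0"
      unfolding tendsto_iff
    proof (intro allI impI)
      fix e :: real assume "0 < e"
      then have "\<forall>\<^sub>F n in sequentially. \<forall>x\<in>path_image g. dist ((f ^^ n) x) 0 < e / 2"
        using uniform_limitD[OF ul, of "e / 2"] by simp
      then show "\<forall>\<^sub>F n in sequentially. dist ((f ^^ n) z) 0 < e"
      proof eventually_elim
        case (elim n)
        have "norm ((f ^^ n) z) \<le> e / 2"
        proof (rule maximum_modulus_frontier[OF holomorphic_funpow continuous_funpow _ _ z])
          show "bounded (inside (path_image g))" by (intro bounded_inside compact_imp_bounded cg)
          show "norm ((f ^^ n) x) \<le> e / 2" if "x \<in> frontier (inside (path_image g))" for x
            using elim fr that by (force simp: less_imp_le)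
        qed
        then show ?case using \<open>0 < e\<close> by simp
      qed
    qed
    then show False using g by (simp add: basin_def)
  qed
qed

end

theorem mainTheorem1:
  fixes lam :: complex and f :: "complex \<Rightarrow> complex" and U :: "complex set"
  assumes "0 < norm lam" and "norm lam < 1"
    and "f = (\<lambda>z. lam * sin z)"
    and "U = connected_component_set (fatou_set f) 0"
  shows "0 \<in> fatou_set f \<and> fatou_set f = U \<and> simply_connected U \<and> completely_invariant f U"
proof -
  interpret S: sine_map lam using assms(1,2) by unfold_locales
  have f: "f = S.f" using assms(3) by (auto simp: S.f_def)
  have F: "fatou_set f = S.basin" unfolding f by (rule S.fatou_set_eq_basin)
  have U: "U = S.basin"
    unfolding assms(4) F using S.immediate_basin_eq_basin by (simp add: S.immediate_basin_def)
  have "completely_invariant f U"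
    unfolding completely_invariant_def U f using S.f_in_basin_iff by blast
  then show ?thesis
    using S.zero_in_basin S.simply_connected_basin by (simp add: F U)
qed

end
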